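(* Let $C\ge1$, let $Q$ be an interval, and let the Bellman functions $\boldsymbol b_{p,C},\boldsymbol B_{2,C},\boldsymbol A_{\delta,C},\boldsymbol D_{\lambda,C}$ and the explicit candidates $b_{p,C},B_{2,C},A_{\delta,C},D_{\lambda,C}$ on $\Omega_C$ be as defined in the context. The following inequalities hold pointwise on $\Omega_C$. (1) If $p\in[1,2]$, then $b_{p,C}\ge\boldsymbol b_{p,C}$. (2) $B_{2,C}\le\boldsymbol B_{2,C}$. (3) For $1\le\delta<1/\xi^+(C)$, $A_{\delta,C}\le\boldsymbol A_{\delta,C}$. (4) For any $\lambda\in\mathbb R$, $D_{\lambda,C}\le\boldsymbol D_{\lambda,C}$.
   Context: **Basic notation.** For an interval $J$, $\langle\varphi\rangle_J=\frac1{|J|}\int_J\varphi$. For an a.e. positive $w$ on an interval $Q$ with $w,\log w$ locally integrable, $[w]_{A_\infty(Q)}=\sup_{J\subset Q}\langle w\rangle_Je^{-\langle\log w\rangle_J}$ (supremum over all subintervals $J$ of $Q$). For $C\ge1$, $\Omega_C=\{x\in\mathbb R^2:\ e^{x_1}\le x_2\le Ce^{x_1}\}$, and for $x\in\Omega_C$ $$E_{x,C,Q}=\{\varphi\in L^1(Q):\ \langle\varphi\rangle_Q=x_1,\ \langle e^\varphi\rangle_Q=x_2,\ [e^\varphi]_{A_\infty(Q)}\le C\}.$$ **Bellman functions.** For $p\in[1,2]$, $\delta\ge1$, $\lambda\in\mathbb R$, $x\in\Omega_C$ (these do not depend on $Q$): $\boldsymbol b_{p,C}(x)=\inf\{\langle|\varphi|^p\rangle_Q:\varphi\in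 E_{x,C,Q}\}$, $\boldsymbol B_{2,C}(x)=\sup\{\langle\varphi^2\rangle_Q:\varphi\in E_{x,C,Q}\}$, $\boldsymbol A_{\delta,C}(x)=\sup\{\langle e^{\delta\varphi}\rangle_Q:\varphi\in E_{x,C,Q}\}$, $\boldsymbol D_{\lambda,C}(x)=\sup\{\frac1{|Q|}|\{t\in Q:\varphi(t)\ge\lambda\}|:\varphi\in E_{x,C,Q}\}$. **Auxiliary functions.** $\xi^\pm=\xi^\pm(C)$ are the two solutions of $e^{-\xi}=C(1-\xi)$ with $-\infty<\xi^-\le0\le\xi^+<1$ (both $0$ when $C=1$, and then $1/\xi^+=\infty$). The functions $u^\pm=u^\pm(x)$ on $\Omega_C$ are defined implicitly by $$x_2=e^{u^\pm}\Big(\frac{x_1-u^\pm}{1-\xi^\pm}+1\Big),\qquad x_1-\xi^+\le u^+\le x_1,\qquad x_1\le u^-\le x_1-\xi^-.$$ **Candidates** (for $C>1$). For $p\in(1,2]$: $$b_{p,C}(x)=\frac p{\xi^+}\,e^{u^+/\xi^+}\Big[\int_{u^+}^\infty|s|^{p-1}\operatorname{sgn}(s)\,e^{-s/\xi^+}ds\Big](x_1-u^+)+|u^+|^p;$$ for $p=2$ this is $b_{2,C}(x)=2u^+x_1-(u^+)^2+2\xi^+(x_1-u^+)$. $$B_{2,C}(x)=2u^-x_1-(u^-)^2+2\xi^-(x_1-u^-).$$ $b_{1,C}$: write $\Omega_C=\Omega_-\cup\Omega_0\cup\Omega_+$ with $\Omega_-=\{x_1\le\xi^-,\ e^{x_1}\le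 x_2\le Ce^{x_1}\}\cup\{\xi^-\le x_1\le0,\ e^{x_1}\le x_2\le Ce^{\xi^-}x_1+1\}$, $\Omega_0=\{\xi^-\le x_1\le0,\ Ce^{\xi^-}x_1+1\le x_2\le Ce^{x_1}\}\cup\{0\le x_1\le\xi^+,\ Ce^{\xi^+}x_1+1\le x_2\le Ce^{x_1}\}$, $\Omega_+=\{0\le x_1\le\xi^+,\ e^{x_1}\le x_2\le Ce^{\xi^+}x_1+1\}\cup\{x_1\ge\xi^+,\ e^{x_1}\le x_2\le Ce^{x_1}\}$. Then $b_{1,C}(x)=-x_1$ on $\Omega_-$, $b_{1,C}(x)=x_1$ on $\Omega_+$, and on $\Omega_0$ $$b_{1,C}(x)=2\,\frac{(1-\xi^-)(1-\xi^+)}{\xi^+-\xi^-}\,(x_2-1)+\frac{\xi^++\xi^--2}{\xi^+-\xi^-}\,x_1.$$ For $1\le\delta<1/\xi^+$: $$A_{\delta,C}(x)=e^{\delta u^+}\Big(\frac{\delta}{1-\delta\xi^+}(x_1-u^+)+1\Big).$$ $D_{\lambda,C}$: write $\Omega_C=\bigcup_{k=1}^4\Omega_k(\lambda)$ with $\Omega_1(\lambda)=\{x_1\le\lambda+\xi^--\xi^+,\ e^{x_1}\le x_2\le Ce^{x_1}\}\cup\{\lambda+\xi^--\xi^+\le x_1\le\lambda+\xi^-,\ e^\lambda(Ce^{\xi^-}(x_1-\lambda)+1)\le x_2\le Ce^{x_1}\}$, $\Omega_2(\lambda)=\{\lambda+\xi^--\xi^+\le x_1<\lambda,\ e^{x_1}\le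 x_2\le e^\lambda(Ce^{\xi^-}(x_1-\lambda)+1)\}$, $\Omega_3(\lambda)=\{\lambda+\xi^-\le x_1\le\lambda,\ e^\lambda(Ce^{\xi^-}(x_1-\lambda)+1)\le x_2\le Ce^{x_1}\}\cup\{\lambda\le x_1\le\lambda+\xi^+,\ e^\lambda(Ce^{\xi^+}(x_1-\lambda)+1)\le x_2\le Ce^{x_1}\}$, $\Omega_4(\lambda)=\{\lambda\le x_1\le\lambda+\xi^+,\ e^{x_1}\le x_2\le e^\lambda(Ce^{\xi^+}(x_1-\lambda)+1)\}\cup\{x_1\ge\lambda+\xi^+,\ e^{x_1}\le x_2\le Ce^{x_1}\}$. For $x\in\Omega_2(\lambda)$ let $v=v(x)<\lambda$ be the horizontal coordinate of the second point where the line through $(\lambda,e^\lambda)$ and $x$ meets the curve $x_2=e^{x_1}$, i.e. $\frac{e^v-e^\lambda}{v-\lambda}=\frac{x_2-e^\lambda}{x_1-\lambda}$. Then $$D_{\lambda,C}(x)=\begin{cases}1,&x\in\Omega_4(\lambda),\\ \frac{1-\xi^-}{(\xi^+-\xi^-)^2}\big[x_1-\lambda+(1-x_2e^{-\lambda})(1-\xi^+)\big]+1,&x\in\Omega_3(\lambda),\\ \frac{x_1-v}{\lambda-v},&x\in\Omega_2(\lambda),\\ \frac{1}{\xi^+-\xi^-}\,e^{(\xi^+-\xi^-+u^+-\lambda)/\xi^+}\,(x_1-u^+),&x\in\Omega_1(\lambda).\end{cases}$$ **Case $C=1$.** Then $\Omega_1=\{x_2=e^{x_1}\}$ and the candidates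 are understood as $b_{p,1}(t,e^t)=|t|^p$, $B_{2,1}(t,e^t)=t^2$, $A_{\delta,1}(t,e^t)=e^{\delta t}$, $D_{\lambda,1}(t,e^t)=\chi_{[\lambda,\infty)}(t)$. *)

theory Defs
  imports "HOL-Analysis.Analysis"
begin

section \<open>Averages and the class of test functions\<close>

definition bdd_interval :: "real set \<Rightarrow> bool" where
  "bdd_interval J \<longleftrightarrow> is_interval J \<and> bounded J \<and> interior J \<noteq> {}"

definition avg :: "real set \<Rightarrow> (real \<Rightarrow> real) \<Rightarrow> real" where
  "avg J f = (LINT t:J|lebesgue. f t) / measure lebesgue J"

text \<open>The average of a nonnegative measurable function that need not be integrable: it is
  \<open>\<infinity>\<close> when the integral diverges, whereas \<^const>\<open>avg\<close> would return the default value 0.\<close>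

definition nn_avg :: "real set \<Rightarrow> (real \<Rightarrow> real) \<Rightarrow> ereal" where
  "nn_avg J f = enn2ereal ((\<integral>\<^sup>+t\<in>J. ennreal (f t) \<partial>lebesgue) / emeasure lebesgue J)"

text \<open>Meaningful when \<open>w\<close> and \<open>ln \<circ> w\<close> are integrable over every subinterval of \<open>Q\<close>, which
  holds for the functions \<open>w = exp \<circ> \<phi>\<close> it is applied to below.\<close>

definition A_infty_char :: "real set \<Rightarrow> (real \<Rightarrow> real) \<Rightarrow> ereal" where
  "A_infty_char Q w =
     (SUP J \<in> {J. bdd_interval J \<and> J \<subseteq> Q}. ereal (avg J w * exp (- avg J (\<lambda>t. ln (w t)))))"

definition Omega :: "real \<Rightarrow> (real \<times> real) set" where
  "Omega C = {(x1, x2). exp x1 \<le> x2 \<and> x2 \<le> C * exp x1}"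

definition E_class :: "real \<times> real \<Rightarrow> real \<Rightarrow> real set \<Rightarrow> (real \<Rightarrow> real) set" where
  "E_class x C Q = {\<phi>.
     set_integrable lebesgue Q \<phi> \<and> set_integrable lebesgue Q (\<lambda>t. exp (\<phi> t)) \<and>
     avg Q \<phi> = fst x \<and> avg Q (\<lambda>t. exp (\<phi> t)) = snd x \<and>
     A_infty_char Q (\<lambda>t. exp (\<phi> t)) \<le> ereal C}"

section \<open>Bellman functions\<close>

definition bellman_b :: "real \<Rightarrow> real \<Rightarrow> real set \<Rightarrow> real \<times> real \<Rightarrow> ereal" where
  "bellman_b p C Q x = (INF \<phi> \<in> E_class x C Q. nn_avg Q (\<lambda>t. \<bar>\<phi> t\<bar> powr p))"

definition bellman_B2 :: "real \<Rightarrow> real set \<Rightarrow> real \<times> real \<Rightarrow> ereal" where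
  "bellman_B2 C Q x = (SUP \<phi> \<in> E_class x C Q. nn_avg Q (\<lambda>t. (\<phi> t)\<^sup>2))"

definition bellman_A :: "real \<Rightarrow> real \<Rightarrow> real set \<Rightarrow> real \<times> real \<Rightarrow> ereal" where
  "bellman_A \<delta> C Q x = (SUP \<phi> \<in> E_class x C Q. nn_avg Q (\<lambda>t. exp (\<delta> * \<phi> t)))"

definition bellman_D :: "real \<Rightarrow> real \<Rightarrow> real set \<Rightarrow> real \<times> real \<Rightarrow> ereal" where
  "bellman_D lam C Q x =
     (SUP \<phi> \<in> E_class x C Q.
        ereal (measure lebesgue {t \<in> Q. \<phi> t \<ge> lam} / measure lebesgue Q))"

section \<open>Auxiliary functions\<close>

text \<open>For \<open>C \<ge> 1\<close> the function \<open>\<xi> \<mapsto> exp (-\<xi>) / (1 - \<xi>)\<close> is strictly decreasing on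
  \<open>(-\<infinity>, 0]\<close> and strictly increasing on \<open>[0, 1)\<close>, with minimum 1 at 0 and limit \<open>\<infinity>\<close> at both
  ends, so both descriptions are proper.  Likewise \<open>u_plus C x\<close> and \<open>u_minus C x\<close> are uniquely
  determined for \<open>x \<in> Omega C\<close>.\<close>

definition xi_plus :: "real \<Rightarrow> real" where
  "xi_plus C = (THE \<xi>. 0 \<le> \<xi> \<and> \<xi> < 1 \<and> exp (- \<xi>) = C * (1 - \<xi>))"

definition xi_minus :: "real \<Rightarrow> real" where
  "xi_minus C = (THE \<xi>. \<xi> \<le> 0 \<and> exp (- \<xi>) = C * (1 - \<xi>))"

definition u_plus :: "real \<Rightarrow> real \<times> real \<Rightarrow> real" where
  "u_plus C = (\<lambda>(x1, x2). THE u.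
     x2 = exp u * ((x1 - u) / (1 - xi_plus C) + 1) \<and> x1 - xi_plus C \<le> u \<and> u \<le> x1)"

definition u_minus :: "real \<Rightarrow> real \<times> real \<Rightarrow> real" where
  "u_minus C = (\<lambda>(x1, x2). THE u.
     x2 = exp u * ((x1 - u) / (1 - xi_minus C) + 1) \<and> x1 \<le> u \<and> u \<le> x1 - xi_minus C)"

section \<open>Candidates\<close>

text \<open>In the piecewise definitions below the regions cover \<open>Omega C\<close> and the formulas agree where
  two regions overlap, so the order of the branches is immaterial.  In each candidate the branch
  \<open>C = 1\<close> concerns points \<open>(t, exp t)\<close> only, whence it depends on \<open>x1\<close> alone.\<close>

definition Omega_minus :: "real \<Rightarrow> (real \<times> real) set" where
  "Omega_minus C =
     {(x1, x2). x1 \<le> xi_minus C \<and> exp x1 \<le> x2 \<and> x2 \<le> C * exp x1} \<union>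
     {(x1, x2). xi_minus C \<le> x1 \<and> x1 \<le> 0 \<and>
        exp x1 \<le> x2 \<and> x2 \<le> C * exp (xi_minus C) * x1 + 1}"

definition Omega_zero :: "real \<Rightarrow> (real \<times> real) set" where
  "Omega_zero C =
     {(x1, x2). xi_minus C \<le> x1 \<and> x1 \<le> 0 \<and>
        C * exp (xi_minus C) * x1 + 1 \<le> x2 \<and> x2 \<le> C * exp x1} \<union>
     {(x1, x2). 0 \<le> x1 \<and> x1 \<le> xi_plus C \<and>
        C * exp (xi_plus C) * x1 + 1 \<le> x2 \<and> x2 \<le> C * exp x1}"

definition Omega_plus :: "real \<Rightarrow> (real \<times> real) set" where
  "Omega_plus C =
     {(x1, x2). 0 \<le> x1 \<and> x1 \<le> xi_plus C \<and>
        exp x1 \<le> x2 \<and> x2 \<le> C * exp (xi_plus C) * x1 + 1} \<union>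
     {(x1, x2). xi_plus C \<le> x1 \<and> exp x1 \<le> x2 \<and> x2 \<le> C * exp x1}"

lemma Omega_cover: "Omega C \<subseteq> Omega_minus C \<union> Omega_zero C \<union> Omega_plus C"
  by (auto simp: Omega_def Omega_minus_def Omega_zero_def Omega_plus_def)

definition cand_b1 :: "real \<Rightarrow> real \<times> real \<Rightarrow> real" where
  "cand_b1 C x = (let x1 = fst x; x2 = snd x; \<xi>p = xi_plus C; \<xi>m = xi_minus C in
     if x \<in> Omega_minus C then - x1
     else if x \<in> Omega_plus C then x1
     else if x \<in> Omega_zero C then
       2 * ((1 - \<xi>m) * (1 - \<xi>p) / (\<xi>p - \<xi>m)) * (x2 - 1) + (\<xi>p + \<xi>m - 2) / (\<xi>p - \<xi>m) * x1
     else undefined)"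

definition cand_b :: "real \<Rightarrow> real \<Rightarrow> real \<times> real \<Rightarrow> real" where
  "cand_b p C x = (let x1 = fst x; \<xi>p = xi_plus C; u = u_plus C x in
     if C = 1 then \<bar>x1\<bar> powr p
     else if p = 1 then cand_b1 C x
     else p / \<xi>p * exp (u / \<xi>p) *
            (LBINT s:{u..}. \<bar>s\<bar> powr (p - 1) * sgn s * exp (- s / \<xi>p)) * (x1 - u)
          + \<bar>u\<bar> powr p)"

definition cand_B2 :: "real \<Rightarrow> real \<times> real \<Rightarrow> real" where
  "cand_B2 C x = (let x1 = fst x; u = u_minus C x in
     if C = 1 then x1\<^sup>2
     else 2 * u * x1 - u\<^sup>2 + 2 * xi_minus C * (x1 - u))"

definition cand_A :: "real \<Rightarrow> real \<Rightarrow> real \<times> real \<Rightarrow> real" where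
  "cand_A \<delta> C x = (let x1 = fst x; u = u_plus C x in
     if C = 1 then exp (\<delta> * x1)
     else exp (\<delta> * u) * (\<delta> / (1 - \<delta> * xi_plus C) * (x1 - u) + 1))"

definition D_region1 :: "real \<Rightarrow> real \<Rightarrow> (real \<times> real) set" where
  "D_region1 lam C =
     {(x1, x2). x1 \<le> lam + xi_minus C - xi_plus C \<and> exp x1 \<le> x2 \<and> x2 \<le> C * exp x1} \<union>
     {(x1, x2). lam + xi_minus C - xi_plus C \<le> x1 \<and> x1 \<le> lam + xi_minus C \<and>
        exp lam * (C * exp (xi_minus C) * (x1 - lam) + 1) \<le> x2 \<and> x2 \<le> C * exp x1}"

definition D_region2 :: "real \<Rightarrow> real \<Rightarrow> (real \<times> real) set" where
  "D_region2 lam C =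
     {(x1, x2). lam + xi_minus C - xi_plus C \<le> x1 \<and> x1 < lam \<and>
        exp x1 \<le> x2 \<and> x2 \<le> exp lam * (C * exp (xi_minus C) * (x1 - lam) + 1)}"

definition D_region3 :: "real \<Rightarrow> real \<Rightarrow> (real \<times> real) set" where
  "D_region3 lam C =
     {(x1, x2). lam + xi_minus C \<le> x1 \<and> x1 \<le> lam \<and>
        exp lam * (C * exp (xi_minus C) * (x1 - lam) + 1) \<le> x2 \<and> x2 \<le> C * exp x1} \<union>
     {(x1, x2). lam \<le> x1 \<and> x1 \<le> lam + xi_plus C \<and>
        exp lam * (C * exp (xi_plus C) * (x1 - lam) + 1) \<le> x2 \<and> x2 \<le> C * exp x1}"

definition D_region4 :: "real \<Rightarrow> real \<Rightarrow> (real \<times> real) set" where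
  "D_region4 lam C =
     {(x1, x2). lam \<le> x1 \<and> x1 \<le> lam + xi_plus C \<and>
        exp x1 \<le> x2 \<and> x2 \<le> exp lam * (C * exp (xi_plus C) * (x1 - lam) + 1)} \<union>
     {(x1, x2). lam + xi_plus C \<le> x1 \<and> exp x1 \<le> x2 \<and> x2 \<le> C * exp x1}"

lemma D_region_cover:
  "Omega C \<subseteq> D_region1 lam C \<union> D_region2 lam C \<union> D_region3 lam C \<union> D_region4 lam C"
  by (auto simp: Omega_def D_region1_def D_region2_def D_region3_def D_region4_def)

text \<open>For \<open>x\<close> in \<^const>\<open>D_region2\<close>: abscissa of the second point where the line through
  \<open>(lam, exp lam)\<close> and \<open>x\<close> meets the graph of \<^const>\<open>exp\<close>.\<close>

definition v_chord :: "real \<Rightarrow> real \<times> real \<Rightarrow> real" where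
  "v_chord lam = (\<lambda>(x1, x2). THE v.
     v < lam \<and> (exp v - exp lam) / (v - lam) = (x2 - exp lam) / (x1 - lam))"

definition cand_D :: "real \<Rightarrow> real \<Rightarrow> real \<times> real \<Rightarrow> real" where
  "cand_D lam C x =
     (let x1 = fst x; x2 = snd x; \<xi>p = xi_plus C; \<xi>m = xi_minus C; u = u_plus C x; v = v_chord lam x in
     if C = 1 then indicator {lam..} x1
     else if x \<in> D_region4 lam C then 1
     else if x \<in> D_region3 lam C then
       (1 - \<xi>m) / (\<xi>p - \<xi>m)\<^sup>2 * (x1 - lam + (1 - x2 * exp (- lam)) * (1 - \<xi>p)) + 1
     else if x \<in> D_region2 lam C then (x1 - v) / (lam - v)
     else if x \<in> D_region1 lam C then
       1 / (\<xi>p - \<xi>m) * exp ((\<xi>p - \<xi>m + u - lam) / \<xi>p) * (x1 - u)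
     else undefined)"

end

theory Submission
  imports Defs
begin

text \<open>Each inequality is proved by an explicit test function. The Bellman point of
  \<open>u + \<xi> ln (s / t)\<close> on \<open>(0, b)\<close> lies on the upper boundary \<open>x2 = C exp x1\<close> for every \<open>b \<le> s\<close>;
  continuing the logarithm by the constant \<open>u\<close> moves the point along the tangent through
  \<open>(u, exp u)\<close>, which is how \<open>u\<^sup>+\<close> and \<open>u\<^sup>-\<close> enter. These functions serve \<open>b_p\<close> for \<open>p > 1\<close>, \<open>B_2\<close>,
  \<open>A_\<delta>\<close> and the outer regions of \<open>b_1\<close> and \<open>D_\<lambda>\<close>. In the other regions a piece is replaced by a
  two-valued step whose chord touches the upper boundary, so that its Bellman point is the same;
  in the angular regions the function is a logarithm, then a constant, then a step.

  To see that a subinterval \<open>J\<close> has its Bellman point below the convex upper boundary it suffices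
  that the integral over \<open>J\<close> of the difference between \<open>exp \<phi>\<close> and some tangent
  \<open>C exp m (1 + \<phi> - m)\<close> is nonpositive. For a good choice of \<open>m\<close> the integral is nonpositive over a
  larger interval and nonnegative over the pieces that are removed to obtain \<open>J\<close>.\<close>

section \<open>The function \<open>exp z * (1 - z)\<close> and the auxiliary functions\<close>

definition kap :: "real \<Rightarrow> real" where
  "kap z = exp z * (1 - z)"

lemma one_plus_less_exp:
  fixes z :: real
  assumes "z \<noteq> 0"
  shows "1 + z < exp z"
proof -
  have "1 + z \<noteq> exp z"
  proof
    assume "1 + z = exp z"
    then have "ln (exp z) = exp z - 1" by simp
    then have "exp z = 1" by (rule ln_eq_minus_one[rotated]) simp
    then show False using assms by simp
  qed
  then show ?thesis using exp_ge_add_one_self[of z] by linarith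
qed

lemma kap_less_iff_aux: "kap y < kap x \<longleftrightarrow> exp (y - x) * (1 - y) < 1 - x"
proof -
  have "kap y = exp x * (exp (y - x) * (1 - y))"
    by (simp add: kap_def mult.assoc[symmetric] mult_exp_exp)
  then show ?thesis by (simp only: kap_def[of x]) simp
qed

lemma kap_decreasing:
  assumes "0 \<le> x" "x < y"
  shows "kap y < kap x"
proof (cases "y < 1")
  case True
  let ?d = "y - x"
  have "1 - ?d < exp (- ?d)" using one_plus_less_exp[of "- ?d"] assms by simp
  then have "(1 - x) * (1 - ?d) < (1 - x) * exp (- ?d)" using assms True by simp
  moreover have "(1 - x) * (1 - ?d) = 1 - y + x * ?d" by (simp add: algebra_simps)
  moreover have "0 \<le> x * ?d" using assms by simp
  ultimately have "1 - y < (1 - x) * exp (- ?d)" by linarith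
  then have "exp ?d * (1 - y) < exp ?d * ((1 - x) * exp (- ?d))" by simp
  also have "\<dots> = 1 - x"
    using mult_exp_exp[of ?d "- ?d"] by (simp add: mult.left_commute)
  finally show ?thesis by (simp add: kap_less_iff_aux)
next
  case False
  then have "exp (y - x) * (y - 1) \<ge> 1 * (y - 1)"
    using assms by (intro mult_right_mono) auto
  then show ?thesis using assms unfolding kap_less_iff_aux by (simp add: algebra_simps)
qed

lemma kap_increasing:
  assumes "y < x" "x \<le> 0"
  shows "kap y < kap x"
proof -
  let ?d = "x - y"
  have "1 + ?d < exp ?d" using one_plus_less_exp[of ?d] assms by simp
  then have "(1 - x) * (1 + ?d) < (1 - x) * exp ?d" using assms by simp
  moreover have "(1 - x) * (1 + ?d) = 1 - y - x * ?d" by (simp add: algebra_simps)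
  moreover have "x * ?d \<le> 0" using assms by (simp add: mult_nonpos_nonneg)
  ultimately have "1 - y < (1 - x) * exp ?d" by linarith
  then have "exp (- ?d) * (1 - y) < exp (- ?d) * ((1 - x) * exp ?d)" by simp
  also have "\<dots> = 1 - x"
    using mult_exp_exp[of "- ?d" ?d] by (simp add: mult.left_commute)
  finally show ?thesis by (simp add: kap_less_iff_aux)
qed

lemma kap_le_decreasing: "0 \<le> x \<Longrightarrow> x \<le> y \<Longrightarrow> kap y \<le> kap x"
  using kap_decreasing[of x y] by (cases "x = y") auto

lemma kap_le_increasing: "y \<le> x \<Longrightarrow> x \<le> 0 \<Longrightarrow> kap y \<le> kap x"
  using kap_increasing[of y x] by (cases "x = y") auto

lemma root_iff_kap:
  assumes "1 \<le> C"
  shows "exp (- \<xi>) = C * (1 - \<xi>) \<longleftrightarrow> kap \<xi> = 1 / C"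
  using assms by (auto simp: kap_def exp_minus field_simps)

lemma xi_plus_root:
  assumes "1 \<le> C"
  shows "0 \<le> xi_plus C \<and> xi_plus C < 1 \<and> kap (xi_plus C) = 1 / C"
proof -
  have "\<exists>\<xi>. 0 \<le> \<xi> \<and> \<xi> \<le> 1 \<and> kap \<xi> = 1 / C"
    using assms by (intro IVT2') (auto simp: kap_def intro!: continuous_intros)
  then obtain \<xi> where \<xi>: "0 \<le> \<xi>" "\<xi> \<le> 1" "kap \<xi> = 1 / C" by blast
  then have "\<xi> \<noteq> 1" using assms by (auto simp: kap_def)
  have "\<exists>!\<xi>. 0 \<le> \<xi> \<and> \<xi> < 1 \<and> exp (- \<xi>) = C * (1 - \<xi>)"
    unfolding root_iff_kap[OF assms]
  proof (rule ex1I[of _ \<xi>])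
    show "0 \<le> \<xi> \<and> \<xi> < 1 \<and> kap \<xi> = 1 / C" using \<xi> \<open>\<xi> \<noteq> 1\<close> by auto
    fix z assume "0 \<le> z \<and> z < 1 \<and> kap z = 1 / C"
    then show "z = \<xi>" using \<xi> kap_decreasing[of z \<xi>] kap_decreasing[of \<xi> z] by linarith
  qed
  from theI'[OF this] show ?thesis
    by (simp add: xi_plus_def root_iff_kap[OF assms])
qed

lemma xi_minus_root:
  assumes "1 \<le> C"
  shows "xi_minus C \<le> 0 \<and> kap (xi_minus C) = 1 / C"
proof -
  define y where "y = 2 * C + 2"
  have "C * (1 + y) \<le> 1 + y + y\<^sup>2 / 2"
    using assms by (simp add: y_def power2_eq_square field_simps)
  also have "\<dots> \<le> exp y"
    using exp_lower_Taylor_quadratic[of y] assms by (simp add: y_def)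
  finally have *: "kap (- y) \<le> 1 / C"
    using assms by (simp add: kap_def exp_minus field_simps)
  have "\<exists>\<xi>. - y \<le> \<xi> \<and> \<xi> \<le> 0 \<and> kap \<xi> = 1 / C"
    using assms * by (intro IVT') (auto simp: kap_def y_def intro!: continuous_intros)
  then obtain \<xi> where \<xi>: "\<xi> \<le> 0" "kap \<xi> = 1 / C" by blast
  have "\<exists>!\<xi>. \<xi> \<le> 0 \<and> exp (- \<xi>) = C * (1 - \<xi>)"
    unfolding root_iff_kap[OF assms]
  proof (rule ex1I[of _ \<xi>])
    show "\<xi> \<le> 0 \<and> kap \<xi> = 1 / C" using \<xi> by auto
    fix z assume "z \<le> 0 \<and> kap z = 1 / C"
    then show "z = \<xi>" using \<xi> kap_increasing[of z \<xi>] kap_increasing[of \<xi> z] by linarith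
  qed
  from theI'[OF this] show ?thesis
    by (simp add: xi_minus_def root_iff_kap[OF assms])
qed

lemma exp_root:
  assumes "1 \<le> C" "kap \<xi> = 1 / C"
  shows "exp \<xi> = 1 / (C * (1 - \<xi>))" "\<xi> \<noteq> 1"
proof -
  show "\<xi> \<noteq> 1" using assms by (auto simp: kap_def)
  then show "exp \<xi> = 1 / (C * (1 - \<xi>))" using assms by (simp add: kap_def field_simps)
qed

lemma root_nonzero: "1 < C \<Longrightarrow> kap \<xi> = 1 / C \<Longrightarrow> \<xi> \<noteq> 0"
  by (auto simp: kap_def)

lemma fan_iff_kap:
  assumes "1 \<le> C" "kap \<xi> = 1 / C"
  shows "x2 = exp u * ((x1 - u) / (1 - \<xi>) + 1) \<longleftrightarrow> kap (u - x1 + \<xi>) = x2 * exp (- x1) / C"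
    and "x2 \<le> exp u * ((x1 - u) / (1 - \<xi>) + 1) \<longleftrightarrow> x2 * exp (- x1) / C \<le> kap (u - x1 + \<xi>)"
    and "exp u * ((x1 - u) / (1 - \<xi>) + 1) \<le> x2 \<longleftrightarrow> kap (u - x1 + \<xi>) \<le> x2 * exp (- x1) / C"
proof -
  have "kap (u - x1 + \<xi>) = exp u * exp (- x1) * (exp \<xi> * (1 - (u - x1 + \<xi>)))"
    by (simp add: kap_def mult.assoc[symmetric] mult_exp_exp)
  also have "exp \<xi> * (1 - (u - x1 + \<xi>)) = ((x1 - u) / (1 - \<xi>) + 1) / C"
    using assms(1) exp_root[OF assms] by (simp add: field_simps)
  also have "exp u * exp (- x1) * (((x1 - u) / (1 - \<xi>) + 1) / C) =
      exp (- x1) / C * (exp u * ((x1 - u) / (1 - \<xi>) + 1))" by simp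
  finally have *: "kap (u - x1 + \<xi>) = exp (- x1) / C * (exp u * ((x1 - u) / (1 - \<xi>) + 1))" .
  have c: "0 < exp (- x1) / C" "x2 * exp (- x1) / C = exp (- x1) / C * x2" using assms by auto
  show "x2 = exp u * ((x1 - u) / (1 - \<xi>) + 1) \<longleftrightarrow> kap (u - x1 + \<xi>) = x2 * exp (- x1) / C"
    unfolding * c(2) using c(1) by (metis mult_cancel_left less_irrefl)
  show "x2 \<le> exp u * ((x1 - u) / (1 - \<xi>) + 1) \<longleftrightarrow> x2 * exp (- x1) / C \<le> kap (u - x1 + \<xi>)"
    unfolding * c(2) by (rule mult_le_cancel_left_pos[OF c(1), symmetric])
  show "exp u * ((x1 - u) / (1 - \<xi>) + 1) \<le> x2 \<longleftrightarrow> kap (u - x1 + \<xi>) \<le> x2 * exp (- x1) / C"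
    unfolding * c(2) by (rule mult_le_cancel_left_pos[OF c(1), symmetric])
qed

lemma Omega_scaled:
  assumes "1 \<le> C" "(x1, x2) \<in> Omega C"
  shows "1 / C \<le> x2 * exp (- x1) / C" "x2 * exp (- x1) / C \<le> 1"
  using assms by (auto simp: Omega_def exp_minus field_simps)

lemma u_plus_props:
  assumes C: "1 \<le> C" and x: "(x1, x2) \<in> Omega C"
  defines "u \<equiv> u_plus C (x1, x2)" and "\<xi> \<equiv> xi_plus C"
  shows "x2 = exp u * ((x1 - u) / (1 - \<xi>) + 1)" "x1 - \<xi> \<le> u" "u \<le> x1"
proof -
  note \<xi> = xi_plus_root[OF C, folded \<xi>_def]
  note fan = fan_iff_kap[OF C, of \<xi>]
  note sc = Omega_scaled[OF C x]
  have "\<exists>z. 0 \<le> z \<and> z \<le> \<xi> \<and> kap z = x2 * exp (- x1) / C"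
    using sc \<xi> by (intro IVT2') (auto simp: kap_def intro!: continuous_intros)
  then obtain z where z: "0 \<le> z" "z \<le> \<xi>" "kap z = x2 * exp (- x1) / C" by blast
  have "\<exists>!u. x2 = exp u * ((x1 - u) / (1 - \<xi>) + 1) \<and> x1 - \<xi> \<le> u \<and> u \<le> x1"
  proof (rule ex1I[of _ "z + x1 - \<xi>"])
    show "x2 = exp (z + x1 - \<xi>) * ((x1 - (z + x1 - \<xi>)) / (1 - \<xi>) + 1) \<and>
      x1 - \<xi> \<le> z + x1 - \<xi> \<and> z + x1 - \<xi> \<le> x1"
      unfolding fan(1)[OF conjunct2[OF conjunct2[OF \<xi>]]] using z by auto
    fix u assume "x2 = exp u * ((x1 - u) / (1 - \<xi>) + 1) \<and> x1 - \<xi> \<le> u \<and> u \<le> x1"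
    then have "kap (u - x1 + \<xi>) = kap z" "0 \<le> u - x1 + \<xi>"
      using fan(1)[of x2 u x1] \<xi> z by auto
    then have "u - x1 + \<xi> = z"
      using z kap_decreasing[of z "u - x1 + \<xi>"] kap_decreasing[of "u - x1 + \<xi>" z] by linarith
    then show "u = z + x1 - \<xi>" by simp
  qed
  from theI'[OF this] show "x2 = exp u * ((x1 - u) / (1 - \<xi>) + 1)" "x1 - \<xi> \<le> u" "u \<le> x1"
    by (simp_all add: u_def u_plus_def \<xi>_def)
qed

lemma u_minus_props:
  assumes C: "1 \<le> C" and x: "(x1, x2) \<in> Omega C"
  defines "u \<equiv> u_minus C (x1, x2)" and "\<xi> \<equiv> xi_minus C"
  shows "x2 = exp u * ((x1 - u) / (1 - \<xi>) + 1)" "x1 \<le> u" "u \<le> x1 - \<xi>"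
proof -
  note \<xi> = xi_minus_root[OF C, folded \<xi>_def]
  note fan = fan_iff_kap[OF C, of \<xi>]
  note sc = Omega_scaled[OF C x]
  have "\<exists>z. \<xi> \<le> z \<and> z \<le> 0 \<and> kap z = x2 * exp (- x1) / C"
    using sc \<xi> by (intro IVT') (auto simp: kap_def intro!: continuous_intros)
  then obtain z where z: "\<xi> \<le> z" "z \<le> 0" "kap z = x2 * exp (- x1) / C" by blast
  have "\<exists>!u. x2 = exp u * ((x1 - u) / (1 - \<xi>) + 1) \<and> x1 \<le> u \<and> u \<le> x1 - \<xi>"
  proof (rule ex1I[of _ "z + x1 - \<xi>"])
    show "x2 = exp (z + x1 - \<xi>) * ((x1 - (z + x1 - \<xi>)) / (1 - \<xi>) + 1) \<and>
      x1 \<le> z + x1 - \<xi> \<and> z + x1 - \<xi> \<le> x1 - \<xi>"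
      unfolding fan(1)[OF conjunct2[OF \<xi>]] using z by auto
    fix u assume "x2 = exp u * ((x1 - u) / (1 - \<xi>) + 1) \<and> x1 \<le> u \<and> u \<le> x1 - \<xi>"
    then have "kap (u - x1 + \<xi>) = kap z" "u - x1 + \<xi> \<le> 0"
      using fan(1)[of x2 u x1] \<xi> z by auto
    then have "u - x1 + \<xi> = z"
      using z kap_increasing[of z "u - x1 + \<xi>"] kap_increasing[of "u - x1 + \<xi>" z] by linarith
    then show "u = z + x1 - \<xi>" by simp
  qed
  from theI'[OF this] show "x2 = exp u * ((x1 - u) / (1 - \<xi>) + 1)" "x1 \<le> u" "u \<le> x1 - \<xi>"
    by (simp_all add: u_minus_def u_def \<xi>_def)
qed

lemma u_plus_le_iff:
  assumes C: "1 \<le> C" and x: "(x1, x2) \<in> Omega C"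
    and w: "x1 - xi_plus C \<le> w"
  shows "u_plus C (x1, x2) \<le> w \<longleftrightarrow> exp w * ((x1 - w) / (1 - xi_plus C) + 1) \<le> x2"
    and "w \<le> u_plus C (x1, x2) \<longleftrightarrow> x2 \<le> exp w * ((x1 - w) / (1 - xi_plus C) + 1)"
proof -
  let ?\<xi> = "xi_plus C" and ?u = "u_plus C (x1, x2)"
  have \<xi>: "kap ?\<xi> = 1 / C" using xi_plus_root[OF C] by simp
  note fan = fan_iff_kap[OF C \<xi>]
  note u = u_plus_props[OF C x]
  have k: "kap (?u - x1 + ?\<xi>) = x2 * exp (- x1) / C" using u(1) fan(1) by blast
  show "?u \<le> w \<longleftrightarrow> exp w * ((x1 - w) / (1 - ?\<xi>) + 1) \<le> x2"
    using w u kap_decreasing[of "w - x1 + ?\<xi>" "?u - x1 + ?\<xi>"]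
      kap_le_decreasing[of "?u - x1 + ?\<xi>" "w - x1 + ?\<xi>"]
    unfolding fan(3) k[symmetric] by linarith
  show "w \<le> ?u \<longleftrightarrow> x2 \<le> exp w * ((x1 - w) / (1 - ?\<xi>) + 1)"
    using w u kap_decreasing[of "?u - x1 + ?\<xi>" "w - x1 + ?\<xi>"]
      kap_le_decreasing[of "w - x1 + ?\<xi>" "?u - x1 + ?\<xi>"]
    unfolding fan(2) k[symmetric] by linarith
qed

lemma u_minus_le:
  assumes C: "1 \<le> C" and x: "(x1, x2) \<in> Omega C"
    and w: "w \<le> x1 - xi_minus C"
    and le: "x2 \<le> exp w * ((x1 - w) / (1 - xi_minus C) + 1)"
  shows "u_minus C (x1, x2) \<le> w"
proof -
  let ?\<xi> = "xi_minus C" and ?u = "u_minus C (x1, x2)"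
  have \<xi>: "kap ?\<xi> = 1 / C" using xi_minus_root[OF C] by simp
  note fan = fan_iff_kap[OF C \<xi>]
  note u = u_minus_props[OF C x]
  have k: "kap (?u - x1 + ?\<xi>) = x2 * exp (- x1) / C" using u(1) fan(1) by blast
  show ?thesis
    using w u le kap_increasing[of "w - x1 + ?\<xi>" "?u - x1 + ?\<xi>"]
    unfolding fan(2) k[symmetric] by linarith
qed

lemma tangent_sign:
  assumes C: "1 \<le> C"
  shows "z \<le> - xi_plus C \<Longrightarrow> C * (1 + z) \<le> exp z"
    and "- xi_minus C \<le> z \<Longrightarrow> C * (1 + z) \<le> exp z"
    and "- xi_plus C \<le> z \<Longrightarrow> z \<le> - xi_minus C \<Longrightarrow> exp z \<le> C * (1 + z)"
proof -
  have le: "C * (1 + z) \<le> exp z \<longleftrightarrow> kap (- z) \<le> 1 / C" "exp z \<le> C * (1 + z) \<longleftrightarrow> 1 / C \<le> kap (- z)"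
    using C by (simp_all add: kap_def exp_minus field_simps)
  note p = xi_plus_root[OF C] and m = xi_minus_root[OF C]
  show "C * (1 + z) \<le> exp z" if "z \<le> - xi_plus C"
    using that p kap_le_decreasing[of "xi_plus C" "- z"] unfolding le by linarith
  show "C * (1 + z) \<le> exp z" if "- xi_minus C \<le> z"
    using that m kap_le_increasing[of "- z" "xi_minus C"] unfolding le by linarith
  show "exp z \<le> C * (1 + z)" if "- xi_plus C \<le> z" "z \<le> - xi_minus C"
    using that m p kap_le_increasing[of "xi_minus C" "- z"] kap_le_decreasing[of "- z" "xi_plus C"]
    unfolding le by linarith
qed

section \<open>Averages over intervals\<close>

lemma bdd_interval_between:
  assumes "bdd_interval J"
  obtains a b where "a < b" "{a<..<b} \<subseteq> J" "J \<subseteq> {a..b}"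
proof -
  let ?a = "Inf J" and ?b = "Sup J"
  have J: "is_interval J" "bdd_below J" "bdd_above J" "J \<noteq> {}" and int: "interior J \<noteq> {}"
    using assms by (auto simp: bdd_interval_def bounded_imp_bdd_below bounded_imp_bdd_above)
  have sub: "J \<subseteq> {?a..?b}" using J by (auto intro: cInf_lower cSup_upper)
  have sup: "{?a<..<?b} \<subseteq> J"
  proof
    fix t assume "t \<in> {?a<..<?b}"
    then obtain y z where "y \<in> J" "y < t" "z \<in> J" "t < z"
      using J by (auto simp: cInf_less_iff less_cSup_iff)
    then show "t \<in> J" using J(1) by (meson less_imp_le mem_is_interval_1_I)
  qed
  have "?a < ?b"
  proof (rule ccontr)
    assume "\<not> ?a < ?b"
    then have "interior J \<subseteq> {}"
      using interior_mono[OF sub] by (cases "?a = ?b") auto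
    then show False using int by simp
  qed
  with sub sup that show ?thesis by blast
qed

lemma measure_between:
  fixes a b :: real
  assumes "a \<le> b" "{a<..<b} \<subseteq> S" "S \<subseteq> {a..b}"
  shows "S \<in> lmeasurable" "measure lebesgue S = b - a" "emeasure lebesgue S = ennreal (b - a)"
proof -
  have "sym_diff {a..b} S \<subseteq> {a, b}"
  proof
    fix t assume "t \<in> sym_diff {a..b} S"
    then have "t \<in> {a..b}" "t \<notin> {a<..<b}" using assms(2,3) by blast+
    then show "t \<in> {a, b}" by auto
  qed
  then have n: "negligible (sym_diff {a..b} S)"
    by (rule negligible_subset[rotated]) simp
  show m: "S \<in> lmeasurable"
    by (rule lmeasurable_negligible_symdiff[OF _ n]) simp
  show ms: "measure lebesgue S = b - a"
    using measure_negligible_symdiff[OF _ n] assms(1) by simp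
  show "emeasure lebesgue S = ennreal (b - a)"
    using m ms by (simp add: emeasure_eq_measure2 fmeasurableD2 emeasure_eq_ennreal_measure)
qed

lemma negligible_between:
  fixes a b :: real
  assumes "{a<..<b} \<subseteq> S" "S \<subseteq> {a..b}"
  shows "negligible {x \<in> {a..b} - S. P x}" "negligible {x \<in> S - {a..b}. P x}"
proof -
  have "{x \<in> {a..b} - S. P x} \<subseteq> {a, b}"
  proof
    fix t assume "t \<in> {x \<in> {a..b} - S. P x}"
    then have "t \<in> {a..b}" "t \<notin> {a<..<b}" using assms(1) by blast+
    then show "t \<in> {a, b}" by auto
  qed
  then show "negligible {x \<in> {a..b} - S. P x}"
    by (rule negligible_subset[rotated]) simp
  have "{x \<in> S - {a..b}. P x} = {}" using assms(2) by blast
  then show "negligible {x \<in> S - {a..b}. P x}" by (simp only: negligible_empty)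
qed

lemma avg_between:
  assumes "a < b" "{a<..<b} \<subseteq> J" "J \<subseteq> {a..b}"
    and f: "f absolutely_integrable_on {a..b}"
  shows "f absolutely_integrable_on J" "avg J f = integral {a..b} f / (b - a)"
proof -
  note n = negligible_between[OF assms(2,3)]
  show i: "f absolutely_integrable_on J"
    by (rule absolutely_integrable_spike_set[OF f]) (rule n)+
  have "integral J f = integral {a..b} f"
    by (rule integral_spike_set) (rule n)+
  then show "avg J f = integral {a..b} f / (b - a)"
    using measure_between(2)[of a b J] assms
    by (simp add: avg_def set_lebesgue_integral_eq_integral(2)[OF i])
qed

lemma nn_avg_between:
  assumes "a < b" "{a<..<b} \<subseteq> J" "J \<subseteq> {a..b}"
    and f: "(f has_integral I) {a..b}" and nonneg: "\<And>t. 0 \<le> f t"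
  shows "nn_avg J f = ereal (I / (b - a))"
proof -
  note n = negligible_between[OF assms(2,3)]
  have "(f has_integral I) J"
    by (rule iffD1[OF has_integral_spike_set_eq f]) (rule n)+
  then have "(\<integral>\<^sup>+t\<in>J. ennreal (f t) \<partial>lebesgue) = ennreal I"
    unfolding nn_integral_completion
    by (intro nn_integral_has_integral_lebesgue') (simp_all add: nonneg)
  moreover have "0 \<le> I" using has_integral_nonneg[OF f] nonneg by simp
  ultimately show ?thesis
    using measure_between(3)[of a b J] assms
    by (simp add: nn_avg_def divide_ennreal)
qed

section \<open>Moments on intervals\<close>

definition moments :: "(real \<Rightarrow> real) \<Rightarrow> real \<Rightarrow> real \<Rightarrow> real \<Rightarrow> real \<Rightarrow> bool" where
  "moments \<phi> a b P R \<longleftrightarrow> a \<le> b \<and>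
     \<phi> absolutely_integrable_on {a..b} \<and> (\<lambda>t. exp (\<phi> t)) absolutely_integrable_on {a..b} \<and>
     integral {a..b} \<phi> = P \<and> integral {a..b} (\<lambda>t. exp (\<phi> t)) = R"

lemma moments_exp_has_integral:
  "moments \<phi> a b P R \<Longrightarrow> ((\<lambda>t. exp (\<phi> t)) has_integral R) {a..b}"
  by (auto simp: moments_def has_integral_iff set_lebesgue_integral_eq_integral(1))

lemma moments_has_integral: "moments \<phi> a b P R \<Longrightarrow> (\<phi> has_integral P) {a..b}"
  by (auto simp: moments_def has_integral_iff set_lebesgue_integral_eq_integral(1))

lemma moments_combine:
  assumes "moments \<phi> a b P R" "moments \<phi> b c P' R'"
  shows "moments \<phi> a c (P + P') (R + R')"
  using has_integral_combine[OF _ _ assms[THEN moments_exp_has_integral]]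
    has_integral_combine[OF _ _ assms[THEN moments_has_integral]] assms
  by (auto simp: moments_def has_integral_iff intro: absolutely_integrable_on_combine)

lemma moments_split:
  assumes "moments \<phi> a c P R" "moments \<phi> a b P' R'" "b \<le> c"
  shows "moments \<phi> b c (P - P') (R - R')"
proof -
  have "moments \<phi> b c (integral {b..c} \<phi>) (integral {b..c} (\<lambda>t. exp (\<phi> t)))"
    using assms unfolding moments_def
    by (auto intro: absolutely_integrable_on_subinterval)
  moreover from moments_combine[OF assms(2) this]
  have "integral {b..c} \<phi> = P - P'" "integral {b..c} (\<lambda>t. exp (\<phi> t)) = R - R'"
    using assms(1) by (auto simp: moments_def)
  ultimately show ?thesis by simp
qed

lemma moments_cong:
  assumes "moments \<phi> a b P R" "\<And>t. a < t \<Longrightarrow> t < b \<Longrightarrow> \<psi> t = \<phi> t"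
  shows "moments \<psi> a b P R"
proof -
  have n: "negligible {a, b}" by simp
  have e: "\<psi> t = \<phi> t" if "t \<in> {a..b} - {a, b}" for t using that assms(2) by auto
  have \<phi>: "\<phi> absolutely_integrable_on {a..b}" "(\<lambda>t. exp (\<phi> t)) absolutely_integrable_on {a..b}"
    using assms(1) by (auto simp: moments_def)
  have "\<psi> absolutely_integrable_on {a..b}" "(\<lambda>t. exp (\<psi> t)) absolutely_integrable_on {a..b}"
    by (rule absolutely_integrable_spike[OF \<phi>(1) n], simp add: e)
      (rule absolutely_integrable_spike[OF \<phi>(2) n], simp add: e)
  moreover have "integral {a..b} \<psi> = integral {a..b} \<phi>"
    "integral {a..b} (\<lambda>t. exp (\<psi> t)) = integral {a..b} (\<lambda>t. exp (\<phi> t))"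
    by (rule integral_spike[OF n], simp add: e)+
  ultimately show ?thesis using assms(1) by (simp add: moments_def)
qed

lemma moments_const:
  assumes "a \<le> b" "\<And>t. a < t \<Longrightarrow> t < b \<Longrightarrow> \<phi> t = k"
  shows "moments \<phi> a b ((b - a) * k) ((b - a) * exp k)"
proof (rule moments_cong)
  show "moments (\<lambda>_. k) a b ((b - a) * k) ((b - a) * exp k)"
    using assms(1) by (simp add: moments_def absolutely_integrable_on_const)
qed (use assms in auto)

text \<open>The map \<open>P, R, d \<mapsto> defect C m P R d\<close> is the integral, over an interval of length \<open>d\<close>,
  of the difference between \<open>exp \<phi>\<close> and the value at \<open>\<phi>\<close> of the tangent to \<open>x2 = C exp x1\<close>
  at \<open>x1 = m\<close>.  It is additive, and it is nonpositive for some \<open>m\<close> exactly when the Bellman point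
  of the interval lies below the upper boundary curve.\<close>

definition defect :: "real \<Rightarrow> real \<Rightarrow> real \<Rightarrow> real \<Rightarrow> real \<Rightarrow> real" where
  "defect C m P R d = R - C * exp m * (P + (1 - m) * d)"

lemma average_le:
  assumes "0 \<le> C" "0 < d" "defect C m P R d \<le> 0"
  shows "R / d \<le> C * exp (P / d)"
proof -
  have "exp m * (1 + (P / d - m)) \<le> exp m * exp (P / d - m)"
    by (intro mult_left_mono) simp_all
  also have "\<dots> = exp (P / d)" by (simp add: mult_exp_exp)
  finally have "C * (exp m * (1 + (P / d - m))) \<le> C * exp (P / d)"
    using assms(1) by (rule mult_left_mono)
  moreover have "R / d \<le> C * (exp m * (1 + (P / d - m)))"
    using assms(2,3) by (simp add: defect_def field_simps)
  ultimately show ?thesis by linarith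
qed

lemma E_class_moments:
  assumes C: "0 \<le> C" and lr: "l < r" "{l<..<r} \<subseteq> Q" "Q \<subseteq> {l..r}"
    and \<phi>: "moments \<phi> l r P R"
    and ok: "\<And>a b. l \<le> a \<Longrightarrow> a < b \<Longrightarrow> b \<le> r \<Longrightarrow>
      \<exists>m P R. moments \<phi> a b P R \<and> defect C m P R (b - a) \<le> 0"
  shows "\<phi> \<in> E_class (P / (r - l), R / (r - l)) C Q"
proof -
  have "avg J (\<lambda>t. exp (\<phi> t)) * exp (- avg J \<phi>) \<le> C" if J: "bdd_interval J" "J \<subseteq> Q" for J
  proof -
    obtain a b where ab: "a < b" "{a<..<b} \<subseteq> J" "J \<subseteq> {a..b}"
      using bdd_interval_between[OF J(1)] .
    have "{a<..<b} \<subseteq> {l..r}" using ab J lr by blast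
    then have "{a..b} \<subseteq> {l..r}"
      using closure_mono[of "{a<..<b}" "{l..r}"] ab(1) by simp
    then have "l \<le> a" "b \<le> r" using ab(1) by auto
    then obtain m P R where mom: "moments \<phi> a b P R" and d: "defect C m P R (b - a) \<le> 0"
      using ok ab(1) by blast
    have av: "avg J \<phi> = P / (b - a)" "avg J (\<lambda>t. exp (\<phi> t)) = R / (b - a)"
      using mom by (auto simp: moments_def avg_between(2)[OF ab])
    have *: "x \<le> C * exp y \<Longrightarrow> x * exp (- y) \<le> C" for x y
      by (simp add: exp_minus field_simps)
    show ?thesis
      unfolding av by (rule *, rule average_le[OF C _ d]) (use ab(1) in simp)
  qed
  then have "A_infty_char Q (\<lambda>t. exp (\<phi> t)) \<le> ereal C"
    unfolding A_infty_char_def by (auto intro!: SUP_least)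
  with \<phi> show ?thesis
    using avg_between[OF lr] by (auto simp: E_class_def moments_def)
qed

section \<open>Logarithms\<close>

lemma has_integral_left_limit:
  fixes G f :: "real \<Rightarrow> real"
  assumes "a \<le> b" and G: "\<And>t. a < t \<Longrightarrow> t \<le> b \<Longrightarrow> (G has_real_derivative f t) (at t)"
    and L: "a < b \<Longrightarrow> (G \<longlongrightarrow> L) (at_right a)" "a = b \<Longrightarrow> L = G b"
  shows "(f has_integral (G b - L)) {a..b}"
proof (cases "a = b")
  case True
  then show ?thesis using L(2) by (simp add: has_integral_refl)
next
  case False
  with assms have ab: "a < b" by simp
  let ?G = "\<lambda>t. if t \<le> a then L else G t"
  have ev: "\<forall>\<^sub>F s in nhds t. ?G s = G s" if "a < t" for t
    using eventually_nhds_in_open[of "{a<..}" t] that by (auto elim!: eventually_mono)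
  have der: "(?G has_real_derivative f t) (at t)" if "a < t" "t \<le> b" for t
    using G[OF that] DERIV_cong_ev[OF refl ev[OF that(1)] refl] by simp
  have "(f has_integral (?G b - ?G a)) {a..b}"
  proof (rule fundamental_theorem_of_calculus_interior[OF assms(1)])
    show "continuous_on {a..b} ?G"
      unfolding continuous_on_eq_continuous_within
    proof
      fix t assume t: "t \<in> {a..b}"
      show "continuous (at t within {a..b}) ?G"
      proof (cases "t = a")
        case True
        have "(?G \<longlongrightarrow> L) (at_right a)"
          using L(1)[OF ab] by (rule Lim_transform_eventually) (auto simp: eventually_at_filter)
        then show ?thesis
          using True ab by (simp add: continuous_within at_within_Icc_at_right)
      next
        case False
        then show ?thesis
          using DERIV_isCont[OF der[of t]] t continuous_at_imp_continuous_within by force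
      qed
    qed
  qed (use der in \<open>auto simp: has_real_derivative_iff_has_vector_derivative\<close>)
  then show ?thesis using ab by simp
qed

lemma log_powers_tendsto_0:
  fixes l :: real
  shows "((\<lambda>t. (t - l) * ln (t - l)) \<longlongrightarrow> 0) (at_right l)"
    and "((\<lambda>t. (t - l) * (ln (t - l))\<^sup>2) \<longlongrightarrow> 0) (at_right l)"
    and "((\<lambda>t. t - l) \<longlongrightarrow> 0) (at_right l)"
    and "\<epsilon> > 0 \<Longrightarrow> ((\<lambda>t. (t - l) powr \<epsilon>) \<longlongrightarrow> 0) (at_right l)"
proof -
  have ev: "\<forall>\<^sub>F h in at_right (0::real). 0 < h"
    by (simp add: eventually_at_filter)
  have 0: "((\<lambda>h::real. h) \<longlongrightarrow> 0) (at_right 0)"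
    by (rule tendsto_ident_at)
  have "((\<lambda>x::real. - (ln x / x)) \<longlongrightarrow> 0) at_top"
    using tendsto_minus[OF ln_x_over_x_tendsto_0] by simp
  then have "((\<lambda>x. inverse x * ln (inverse x)) \<longlongrightarrow> (0::real)) at_top"
    by (rule Lim_transform_eventually)
      (rule eventually_mono[OF eventually_gt_at_top[of 0]], simp add: ln_inverse divide_inverse mult.commute)
  then have 1: "((\<lambda>h::real. h * ln h) \<longlongrightarrow> 0) (at_right 0)"
    unfolding filterlim_at_right_to_top .
  have "filterlim sqrt (at_right 0) (at_right 0)"
    unfolding filterlim_at
    using tendsto_real_sqrt[OF 0] ev by (auto elim!: eventually_mono)
  from filterlim_compose[OF 1 this]
  have "((\<lambda>h. 4 * (sqrt h * ln (sqrt h))\<^sup>2) \<longlongrightarrow> 4 * 0\<^sup>2) (at_right 0)"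
    by (intro tendsto_intros)
  then have "((\<lambda>h. 4 * (sqrt h * ln (sqrt h))\<^sup>2) \<longlongrightarrow> 0) (at_right 0)" by simp
  then have 2: "((\<lambda>h::real. h * (ln h)\<^sup>2) \<longlongrightarrow> 0) (at_right 0)"
    by (rule Lim_transform_eventually)
      (rule eventually_mono[OF ev], simp add: ln_sqrt power_mult_distrib power_divide)
  show "((\<lambda>t. (t - l) * ln (t - l)) \<longlongrightarrow> 0) (at_right l)"
    "((\<lambda>t. (t - l) * (ln (t - l))\<^sup>2) \<longlongrightarrow> 0) (at_right l)"
    "((\<lambda>t. t - l) \<longlongrightarrow> 0) (at_right l)"
    using 0 1 2 by (simp_all add: filterlim_at_right_to_0[where a = l])
  have "((\<lambda>h::real. h powr \<epsilon>) \<longlongrightarrow> 0 powr \<epsilon>) (at_right 0)" if "\<epsilon> > 0"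
    by (rule tendsto_powr'[OF 0 tendsto_const])
      (use that ev in \<open>auto elim!: eventually_mono\<close>)
  then show "\<epsilon> > 0 \<Longrightarrow> ((\<lambda>t. (t - l) powr \<epsilon>) \<longlongrightarrow> 0) (at_right l)"
    by (simp add: filterlim_at_right_to_0[where a = l])
qed

lemma DERIV_ln_quotient:
  fixes l s t :: real
  assumes "0 < s" "l < t"
  shows "((\<lambda>t. ln (s / (t - l))) has_real_derivative - 1 / (t - l)) (at t)"
proof -
  have "((\<lambda>t. ln s - ln (t - l)) has_real_derivative - 1 / (t - l)) (at t)"
    using assms by (auto intro!: derivative_eq_intros simp: field_simps)
  moreover have "\<forall>\<^sub>F x in nhds t. x \<in> {l<..}"
    using assms by (intro eventually_nhds_in_open) auto
  then have "\<forall>\<^sub>F x in nhds t. ln (s / (x - l)) = ln s - ln (x - l)"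
    by (rule eventually_mono) (use assms in \<open>simp add: ln_div\<close>)
  ultimately show ?thesis by (subst DERIV_cong_ev) auto
qed

lemma DERIV_log:
  fixes l s t u \<xi> :: real
  assumes "0 < s" "l < t"
  shows "((\<lambda>t. u + \<xi> * ln (s / (t - l))) has_real_derivative - \<xi> / (t - l)) (at t)"
  using DERIV_add[OF DERIV_const[of u] DERIV_cmult[OF DERIV_ln_quotient[OF assms], of \<xi>]] by simp

lemma log_square_tendsto_0:
  fixes l s u \<xi> :: real
  assumes "0 < s"
  shows "((\<lambda>t. (t - l) * (u + \<xi> * ln (s / (t - l)))\<^sup>2) \<longlongrightarrow> 0) (at_right l)"
proof (rule Lim_transform_eventually)
  let ?c = "u + \<xi> * ln s"
  have "((\<lambda>t. ?c\<^sup>2 * (t - l) - 2 * ?c * \<xi> * ((t - l) * ln (t - l)) + \<xi>\<^sup>2 * ((t - l) * (ln (t - l))\<^sup>2))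
      \<longlongrightarrow> ?c\<^sup>2 * 0 - 2 * ?c * \<xi> * 0 + \<xi>\<^sup>2 * 0) (at_right l)"
    by (intro tendsto_intros log_powers_tendsto_0)
  then show "((\<lambda>t. ?c\<^sup>2 * (t - l) - 2 * ?c * \<xi> * ((t - l) * ln (t - l)) + \<xi>\<^sup>2 * ((t - l) * (ln (t - l))\<^sup>2))
      \<longlongrightarrow> 0) (at_right l)" by simp
  have *: "?c\<^sup>2 * h - 2 * ?c * \<xi> * (h * ln h) + \<xi>\<^sup>2 * (h * (ln h)\<^sup>2) = h * (u + \<xi> * ln (s / h))\<^sup>2"
    if "h > 0" for h
    using assms that by (simp add: ln_div power2_eq_square algebra_simps)
  show "\<forall>\<^sub>F t in at_right l. ?c\<^sup>2 * (t - l) - 2 * ?c * \<xi> * ((t - l) * ln (t - l)) +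
      \<xi>\<^sup>2 * ((t - l) * (ln (t - l))\<^sup>2) = (t - l) * (u + \<xi> * ln (s / (t - l)))\<^sup>2"
    by (rule eventually_mono[of "\<lambda>t. l < t"]) (auto simp: eventually_at_filter intro!: * simp del: distrib_left_numeral)
qed

lemma moments_log:
  assumes lb: "l < b" and s: "0 < s" and \<xi>: "\<xi> < 1"
    and \<phi>: "\<And>t. l < t \<Longrightarrow> t < b \<Longrightarrow> \<phi> t = u + \<xi> * ln (s / (t - l))"
  defines "y \<equiv> u + \<xi> * ln (s / (b - l))"
  shows "moments \<phi> l b ((b - l) * (y + \<xi>)) ((b - l) * (exp y / (1 - \<xi>)))"
proof (rule moments_cong)
  let ?\<psi> = "\<lambda>t. u + \<xi> * ln (s / (t - l))"
  have 1: "(?\<psi> has_integral ((b - l) * (y + \<xi>) - 0)) {l..b}"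
    unfolding y_def
  proof (rule has_integral_left_limit)
    show "((\<lambda>t. (t - l) * (?\<psi> t + \<xi>)) has_real_derivative ?\<psi> t) (at t)" if "l < t" "t \<le> b" for t
      using that s by (auto intro!: derivative_eq_intros DERIV_ln_quotient)
    show "((\<lambda>t. (t - l) * (?\<psi> t + \<xi>)) \<longlongrightarrow> 0) (at_right l)"
    proof (rule Lim_transform_eventually)
      have "((\<lambda>t. (u + \<xi> * ln s + \<xi>) * (t - l) - \<xi> * ((t - l) * ln (t - l)))
          \<longlongrightarrow> (u + \<xi> * ln s + \<xi>) * 0 - \<xi> * 0) (at_right l)"
        by (intro tendsto_intros log_powers_tendsto_0)
      then show "((\<lambda>t. (u + \<xi> * ln s + \<xi>) * (t - l) - \<xi> * ((t - l) * ln (t - l)))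
          \<longlongrightarrow> 0) (at_right l)" by simp
      show "\<forall>\<^sub>F t in at_right l. (u + \<xi> * ln s + \<xi>) * (t - l) - \<xi> * ((t - l) * ln (t - l)) =
          (t - l) * (?\<psi> t + \<xi>)"
        unfolding eventually_at_filter using s
        by (intro always_eventually) (auto simp: ln_div algebra_simps)
    qed
  qed (use lb in auto)
  have 2: "((\<lambda>t. exp (?\<psi> t)) has_integral ((b - l) * (exp y / (1 - \<xi>)) - 0)) {l..b}"
    unfolding y_def
  proof (rule has_integral_left_limit)
    show "((\<lambda>t. (t - l) * (exp (?\<psi> t) / (1 - \<xi>))) has_real_derivative exp (?\<psi> t)) (at t)"
      if "l < t" "t \<le> b" for t
    proof (rule DERIV_cong[OF DERIV_mult[OF DERIV_diff[OF DERIV_ident DERIV_const]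
            DERIV_cdivide[OF DERIV_fun_exp[OF DERIV_log[OF s that(1)]]]]])
      have alg: "(1 - 0) * (E / (1 - \<xi>)) + E * (- \<xi> / h) / (1 - \<xi>) * h = E" if "h > 0" for E h
      proof -
        have "E * (- \<xi> / h) / (1 - \<xi>) * h = - (E * \<xi>) / (1 - \<xi>)" using that by simp
        then have "(1 - 0) * (E / (1 - \<xi>)) + E * (- \<xi> / h) / (1 - \<xi>) * h = E * (1 - \<xi>) / (1 - \<xi>)"
          by (simp only: right_diff_distrib diff_divide_distrib) simp
        then show ?thesis using \<xi> by simp
      qed
      show "(1 - 0) * (exp (?\<psi> t) / (1 - \<xi>)) +
          exp (?\<psi> t) * (- \<xi> / (t - l)) / (1 - \<xi>) * (t - l) = exp (?\<psi> t)"
        by (rule alg) (use that in simp)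
    qed
    show "((\<lambda>t. (t - l) * (exp (?\<psi> t) / (1 - \<xi>))) \<longlongrightarrow> 0) (at_right l)"
    proof (rule Lim_transform_eventually)
      show "((\<lambda>t. exp (u + \<xi> * ln s) / (1 - \<xi>) * (t - l) powr (1 - \<xi>)) \<longlongrightarrow> 0) (at_right l)"
        by (rule tendsto_mult_right_zero, rule log_powers_tendsto_0) (use \<xi> in simp)
      have *: "exp (u + \<xi> * ln s) / (1 - \<xi>) * h powr (1 - \<xi>) =
          h * (exp (u + \<xi> * ln (s / h)) / (1 - \<xi>))" if "h > 0" for h
      proof -
        have "h powr (1 - \<xi>) = h * exp (- \<xi> * ln h)"
          using that by (simp add: powr_def left_diff_distrib exp_diff exp_minus divide_inverse)
        moreover have "exp (u + \<xi> * ln s) * exp (- \<xi> * ln h) = exp (u + \<xi> * ln (s / h))"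
          using that s by (simp add: mult_exp_exp ln_div algebra_simps)
        ultimately show ?thesis by (metis (no_types, lifting) mult.left_commute times_divide_eq_left times_divide_eq_right)
      qed
      show "\<forall>\<^sub>F t in at_right l. exp (u + \<xi> * ln s) / (1 - \<xi>) * (t - l) powr (1 - \<xi>) =
          (t - l) * (exp (?\<psi> t) / (1 - \<xi>))"
        by (rule eventually_mono[of "\<lambda>t. l < t"]) (simp add: eventually_at_filter, rule *, simp)
    qed
  qed (use lb in auto)
  have 3: "?\<psi> absolutely_integrable_on {l..b}"
  proof (cases "0 \<le> \<xi>")
    case True
    have "min u y \<le> ?\<psi> t" if "t \<in> {l..b}" for t
    proof (cases "t = l")
      case False
      then have "ln (s / (b - l)) \<le> ln (s / (t - l))"
        using that s by (simp add: frac_le)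
      then have "y \<le> ?\<psi> t" unfolding y_def using True by (simp add: mult_left_mono)
      then show ?thesis by simp
    qed simp
    then show ?thesis
      by - (rule absolutely_integrable_absolutely_integrable_lbound[OF has_integral_integrable[OF 1],
            where g = "\<lambda>_. min u y"]; simp add: absolutely_integrable_on_const)
  next
    case False
    have "?\<psi> t \<le> max u y" if "t \<in> {l..b}" for t
    proof (cases "t = l")
      case tl: False
      then have "ln (s / (b - l)) \<le> ln (s / (t - l))"
        using that s by (simp add: frac_le)
      then have "?\<psi> t \<le> y" unfolding y_def using False by (simp add: mult_left_mono_neg)
      then show ?thesis by simp
    qed simp
    then show ?thesis
      by - (rule absolutely_integrable_absolutely_integrable_ubound[OF has_integral_integrable[OF 1],
            where g = "\<lambda>_. max u y"]; simp add: absolutely_integrable_on_const)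
  qed
  have 4: "(\<lambda>t. exp (?\<psi> t)) absolutely_integrable_on {l..b}"
    by (rule nonnegative_absolutely_integrable_1[OF has_integral_integrable[OF 2]]) simp
  show "moments ?\<psi> l b ((b - l) * (y + \<xi>)) ((b - l) * (exp y / (1 - \<xi>)))"
    using 1 2 3 4 lb by (auto simp: moments_def)
qed (use \<phi> in auto)

lemma log_square_has_integral:
  fixes l s u \<xi> :: real
  assumes "l < b" "0 < s"
  shows "((\<lambda>t. (u + \<xi> * ln (s / (t - l)))\<^sup>2) has_integral
    (b - l) * ((u + \<xi> * ln (s / (b - l)) + \<xi>)\<^sup>2 + \<xi>\<^sup>2)) {l..b}"
proof -
  let ?\<psi> = "\<lambda>t. u + \<xi> * ln (s / (t - l))"
  have "((\<lambda>t. (?\<psi> t)\<^sup>2) has_integral ((b - l) * ((?\<psi> b + \<xi>)\<^sup>2 + \<xi>\<^sup>2) - 0)) {l..b}"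
  proof (rule has_integral_left_limit[where G = "\<lambda>t. (t - l) * ((?\<psi> t + \<xi>)\<^sup>2 + \<xi>\<^sup>2)"])
    show "((\<lambda>t. (t - l) * ((?\<psi> t + \<xi>)\<^sup>2 + \<xi>\<^sup>2)) has_real_derivative (?\<psi> t)\<^sup>2) (at t)"
      if "l < t" "t \<le> b" for t
    proof -
      have "((\<lambda>t. (t - l) * ((?\<psi> t + \<xi>)\<^sup>2 + \<xi>\<^sup>2)) has_real_derivative
          1 * ((?\<psi> t + \<xi>)\<^sup>2 + \<xi>\<^sup>2) + 2 * (?\<psi> t + \<xi>) * (- \<xi> / (t - l)) * (t - l)) (at t)"
        by (rule derivative_eq_intros DERIV_log[OF assms(2) that(1)] refl)+ simp
      also have "1 * ((y + \<xi>)\<^sup>2 + \<xi>\<^sup>2) + 2 * (y + \<xi>) * (- \<xi> / (t - l)) * (t - l) = y\<^sup>2" for y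
      proof -
        have "2 * (y + \<xi>) * (- \<xi> / (t - l)) * (t - l) = 2 * (y + \<xi>) * (- \<xi>)" using that by simp
        then show ?thesis by (simp only: power2_eq_square) (simp add: algebra_simps)
      qed
      finally show ?thesis .
    qed
    have "((\<lambda>t. (t - l) * (u + \<xi> + \<xi> * ln (s / (t - l)))\<^sup>2 + (t - l) * \<xi>\<^sup>2) \<longlongrightarrow> 0 + 0 * \<xi>\<^sup>2) (at_right l)"
      by (intro tendsto_intros log_square_tendsto_0 log_powers_tendsto_0 assms)
    then show "((\<lambda>t. (t - l) * ((?\<psi> t + \<xi>)\<^sup>2 + \<xi>\<^sup>2)) \<longlongrightarrow> 0) (at_right l)"
      by (simp add: algebra_simps)
  qed (use assms in auto)
  then show ?thesis by simp
qed

section \<open>Test functions\<close>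

lemma moments_refl: "moments \<phi> a a 0 0"
  using moments_const[of a a \<phi> 0] by simp

lemma defect_add: "defect C m (P + P') (R + R') (d + d') = defect C m P R d + defect C m P' R' d'"
  by (simp add: defect_def algebra_simps)

lemma defect_diff: "defect C m (P - P') (R - R') (d - d') = defect C m P R d - defect C m P' R' d'"
  by (simp add: defect_def algebra_simps)

lemma defect_const:
  "defect C m (d * k) (d * exp k) d = d * (exp m * (exp (k - m) - C * (1 + (k - m))))"
  by (simp add: defect_def right_diff_distrib mult_exp_exp algebra_simps)

lemma defect_const_nonneg:
  "C * (1 + (k - m)) \<le> exp (k - m) \<Longrightarrow> 0 \<le> d \<Longrightarrow> 0 \<le> defect C m (d * k) (d * exp k) d"
  by (simp add: defect_const)

lemma defect_const_nonpos:
  "exp (k - m) \<le> C * (1 + (k - m)) \<Longrightarrow> 0 \<le> d \<Longrightarrow> defect C m (d * k) (d * exp k) d \<le> 0"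
  by (simp add: defect_const mult_le_0_iff)

text \<open>The Bellman point of a logarithm lies on the upper boundary curve.\<close>

lemma defect_log:
  assumes C: "1 \<le> C" and \<xi>: "kap \<xi> = 1 / C"
  shows "defect C m (d * (y + \<xi>)) (d * (exp y / (1 - \<xi>))) d =
    d * C * (exp (y + \<xi>) - exp m * (1 + (y + \<xi> - m)))"
proof -
  have "exp y / (1 - \<xi>) = C * exp (y + \<xi>)"
    using C exp_root[OF C \<xi>] by (simp add: exp_add)
  then show ?thesis by (simp add: defect_def algebra_simps)
qed

lemma defect_log_nonneg:
  assumes "1 \<le> C" "kap \<xi> = 1 / C" "0 \<le> d"
  shows "0 \<le> defect C m (d * (y + \<xi>)) (d * (exp y / (1 - \<xi>))) d"
proof -
  have "exp m * (1 + (y + \<xi> - m)) \<le> exp m * exp (y + \<xi> - m)"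
    by (intro mult_left_mono) simp_all
  also have "\<dots> = exp (y + \<xi>)" by (simp add: mult_exp_exp)
  finally show ?thesis unfolding defect_log[OF assms(1,2)] using assms(1,3) by simp
qed

lemma defect_log_zero:
  assumes "1 \<le> C" "kap \<xi> = 1 / C" "m = y + \<xi>"
  shows "defect C m (d * (y + \<xi>)) (d * (exp y / (1 - \<xi>))) d = 0"
  unfolding defect_log[OF assms(1,2)] by (simp add: assms(3))

definition below_curve :: "real \<Rightarrow> (real \<Rightarrow> real) \<Rightarrow> real \<Rightarrow> real \<Rightarrow> bool" where
  "below_curve C \<phi> a b \<longleftrightarrow> (\<exists>m P R. moments \<phi> a b P R \<and> defect C m P R (b - a) \<le> 0)"

lemma below_curve_const:
  assumes "1 \<le> C" "a \<le> b" "\<And>t. a < t \<Longrightarrow> t < b \<Longrightarrow> \<phi> t = k"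
  shows "below_curve C \<phi> a b"
  unfolding below_curve_def
  using moments_const[OF assms(2,3)] defect_const_nonpos[of k k C "b - a"] assms by fastforce

lemma below_curve_cong:
  assumes "below_curve C \<phi> a b" "\<And>t. a < t \<Longrightarrow> t < b \<Longrightarrow> \<psi> t = \<phi> t"
  shows "below_curve C \<psi> a b"
  using assms moments_cong[of \<phi> a b _ _ \<psi>] unfolding below_curve_def by blast

lemma below_curve_remove_left:
  assumes "moments \<phi> l b P R" "defect C m P R (b - l) \<le> 0"
    and "moments \<phi> l a P' R'" "0 \<le> defect C m P' R' (a - l)" "a \<le> b"
  shows "below_curve C \<phi> a b"
proof -
  have "defect C m (P - P') (R - R') (b - a) = defect C m P R (b - l) - defect C m P' R' (a - l)"
    using defect_diff[of C m P P' R R' "b - l" "a - l"] by simp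
  then have "defect C m (P - P') (R - R') (b - a) \<le> 0" using assms(2,4) by simp
  with moments_split[OF assms(1,3,5)] show ?thesis unfolding below_curve_def by blast
qed

lemma E_classI:
  assumes C: "1 \<le> C" and lr: "l < r" "{l<..<r} \<subseteq> Q" "Q \<subseteq> {l..r}"
    and \<phi>: "moments \<phi> l r ((r - l) * x1) ((r - l) * x2)"
    and ok: "\<And>a b. l \<le> a \<Longrightarrow> a < b \<Longrightarrow> b \<le> r \<Longrightarrow> below_curve C \<phi> a b"
  shows "\<phi> \<in> E_class (x1, x2) C Q"
  using E_class_moments[OF _ lr \<phi>, of C] ok C lr(1) by (simp add: below_curve_def)

definition log_step :: "real \<Rightarrow> real \<Rightarrow> real \<Rightarrow> real \<Rightarrow> real \<Rightarrow> real \<Rightarrow> real \<Rightarrow> real" where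
  "log_step l u \<xi> \<alpha> c v t =
     (if t \<le> l + \<alpha> then u + \<xi> * ln (\<alpha> / (t - l)) else if t \<le> c then u else v)"

lemma log_step_moments_log:
  fixes l b \<alpha> \<xi> u c v :: real
  assumes "l < b" "b \<le> l + \<alpha>" "\<xi> < 1"
  defines "y \<equiv> log_step l u \<xi> \<alpha> c v b"
  shows "moments (log_step l u \<xi> \<alpha> c v) l b ((b - l) * (y + \<xi>)) ((b - l) * (exp y / (1 - \<xi>)))"
proof -
  have y: "y = u + \<xi> * ln (\<alpha> / (b - l))" using assms by (simp add: log_step_def)
  show ?thesis
    unfolding y by (rule moments_log) (use assms(1-3) in \<open>auto simp: log_step_def\<close>)
qed

lemma log_step_moments_head:
  assumes "0 \<le> \<alpha>" "l + \<alpha> \<le> b" "b \<le> c" "\<xi> < 1"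
  shows "moments (log_step l u \<xi> \<alpha> c v) l b
    (\<alpha> * (u + \<xi>) + (b - l - \<alpha>) * u) (\<alpha> * (exp u / (1 - \<xi>)) + (b - l - \<alpha>) * exp u)"
proof (rule moments_combine)
  show "moments (log_step l u \<xi> \<alpha> c v) l (l + \<alpha>) (\<alpha> * (u + \<xi>)) (\<alpha> * (exp u / (1 - \<xi>)))"
  proof (cases "\<alpha> = 0")
    case False
    then have "log_step l u \<xi> \<alpha> c v (l + \<alpha>) = u" by (simp add: log_step_def)
    with False show ?thesis
      using log_step_moments_log[of l "l + \<alpha>" \<alpha> \<xi> u c v] assms by simp
  qed (simp add: moments_refl)
  have "b - l - \<alpha> = b - (l + \<alpha>)" by simp
  then show "moments (log_step l u \<xi> \<alpha> c v) (l + \<alpha>) b ((b - l - \<alpha>) * u) ((b - l - \<alpha>) * exp u)"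
    by (simp only:) (rule moments_const, use assms in \<open>auto simp: log_step_def\<close>)
qed

lemma log_step_left_nonneg:
  assumes "1 \<le> C" "kap \<xi> = 1 / C" "\<xi> < 1" "l \<le> a" "a \<le> l + \<alpha>"
  shows "\<exists>P R. moments (log_step l u \<xi> \<alpha> c v) l a P R \<and> (\<forall>m. 0 \<le> defect C m P R (a - l))"
proof (cases "a = l")
  case True
  then show ?thesis using moments_refl by (fastforce simp: defect_def)
next
  case False
  then show ?thesis
    using log_step_moments_log[of l a \<alpha> \<xi>] defect_log_nonneg[of C \<xi> "a - l"] assms by fastforce
qed

lemma log_step_head_zero:
  assumes C: "1 \<le> C" and \<xi>: "kap \<xi> = 1 / C" "\<xi> < 1" and "0 \<le> \<alpha>" "l < b" "b \<le> c" "l + \<alpha> \<le> c"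
  shows "\<exists>P R. moments (log_step l u \<xi> \<alpha> c v) l b P R \<and>
    defect C (log_step l u \<xi> \<alpha> c v b + \<xi>) P R (b - l) = 0"
proof (cases "b \<le> l + \<alpha>")
  case True
  then show ?thesis
    using log_step_moments_log[OF assms(5) True \<xi>(2)] defect_log_zero[OF C \<xi>(1)] by fastforce
next
  case False
  then have y: "log_step l u \<xi> \<alpha> c v b = u" using assms by (simp add: log_step_def)
  have "exp (- \<xi>) - C * (1 - \<xi>) = 0" using \<xi> C by (simp add: root_iff_kap)
  then have "defect C (u + \<xi>) ((b - l - \<alpha>) * u) ((b - l - \<alpha>) * exp u) (b - l - \<alpha>) = 0"
    unfolding defect_const by simp
  then have "defect C (u + \<xi>) (\<alpha> * (u + \<xi>) + (b - l - \<alpha>) * u)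
      (\<alpha> * (exp u / (1 - \<xi>)) + (b - l - \<alpha>) * exp u) (\<alpha> + (b - l - \<alpha>)) = 0"
    unfolding defect_add using defect_log_zero[OF C \<xi>(1) refl, of u \<alpha>] by simp
  moreover have "\<alpha> + (b - l - \<alpha>) = b - l" by simp
  ultimately show ?thesis
    using log_step_moments_head[of \<alpha> l b c \<xi> u v] False assms y by fastforce
qed

lemma log_step_head_below:
  assumes C: "1 \<le> C" and \<xi>: "kap \<xi> = 1 / C" "\<xi> < 1"
    and \<alpha>: "0 \<le> \<alpha>" "l + \<alpha> \<le> c" and ab: "l \<le> a" "a < b" "b \<le> c"
  shows "below_curve C (log_step l u \<xi> \<alpha> c v) a b"
proof (cases "l + \<alpha> \<le> a")
  case True
  then show ?thesis
    using C ab by (intro below_curve_const[where k = u]) (auto simp: log_step_def)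
next
  case False
  then obtain P' R' where "moments (log_step l u \<xi> \<alpha> c v) l a P' R'"
    "\<And>m. 0 \<le> defect C m P' R' (a - l)"
    using log_step_left_nonneg[OF C \<xi> ab(1), where \<alpha> = \<alpha> and u = u and c = c and v = v] by auto
  moreover obtain P R where "moments (log_step l u \<xi> \<alpha> c v) l b P R"
    "defect C (log_step l u \<xi> \<alpha> c v b + \<xi>) P R (b - l) = 0"
    using log_step_head_zero[OF C \<xi> \<alpha>(1) _ ab(3) \<alpha>(2)] ab by (meson le_less_trans)
  ultimately show ?thesis
    using ab by (intro below_curve_remove_left[where m = "log_step l u \<xi> \<alpha> c v b + \<xi>"]) auto
qed

lemma log_E_class:
  assumes C: "1 \<le> C" and \<xi>: "kap \<xi> = 1 / C" "\<xi> < 1"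
    and lr: "l < r" "{l<..<r} \<subseteq> Q" "Q \<subseteq> {l..r}" and s: "0 \<le> s" "s \<le> 1"
    and x: "x1 = u + s * \<xi>" "x2 = exp u * (s * \<xi> / (1 - \<xi>) + 1)"
  shows "log_step l u \<xi> (s * (r - l)) r v \<in> E_class (x1, x2) C Q"
proof (rule E_classI[OF C lr])
  let ?\<alpha> = "s * (r - l)"
  have "?\<alpha> \<le> r - l"
    using s lr(1) by (intro mult_left_le_one_le) auto
  then have "l + ?\<alpha> \<le> r" by (simp only: le_diff_eq add.commute)
  moreover have "0 \<le> ?\<alpha>" using s lr(1) by simp
  ultimately have \<alpha>: "0 \<le> ?\<alpha>" "l + ?\<alpha> \<le> r" by blast+
  have "?\<alpha> * (u + \<xi>) + (r - l - ?\<alpha>) * u = (r - l) * x1"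
    by (simp add: x algebra_simps)
  moreover have "?\<alpha> * (exp u / (1 - \<xi>)) + (r - l - ?\<alpha>) * exp u = (r - l) * x2"
    using \<xi>(2) by (simp add: x field_simps)
  ultimately show "moments (log_step l u \<xi> ?\<alpha> r v) l r ((r - l) * x1) ((r - l) * x2)"
    using log_step_moments_head[OF \<alpha> order_refl \<xi>(2), of u v] by simp
  show "below_curve C (log_step l u \<xi> ?\<alpha> r v) a b" if "l \<le> a" "a < b" "b \<le> r" for a b
    using log_step_head_below[OF C \<xi> \<alpha> that] .
qed

lemma two_values_below:
  assumes ab: "a < b"
    and k: "exp (k - m) \<le> C * (1 + (k - m))" "exp (v - m) \<le> C * (1 + (v - m))"
    and \<phi>: "\<And>t. a < t \<Longrightarrow> t < b \<Longrightarrow> t < c \<Longrightarrow> \<phi> t = k" "\<And>t. a < t \<Longrightarrow> t < b \<Longrightarrow> c < t \<Longrightarrow> \<phi> t = v"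
  shows "below_curve C \<phi> a b"
proof -
  let ?c = "max a (min b c)"
  have "moments \<phi> a ?c ((?c - a) * k) ((?c - a) * exp k)"
    by (rule moments_const) (use \<phi> in auto)
  moreover have "moments \<phi> ?c b ((b - ?c) * v) ((b - ?c) * exp v)"
    by (rule moments_const) (use ab \<phi> in auto)
  ultimately have "moments \<phi> a b ((?c - a) * k + (b - ?c) * v) ((?c - a) * exp k + (b - ?c) * exp v)"
    by (rule moments_combine)
  moreover have "defect C m ((?c - a) * k + (b - ?c) * v) ((?c - a) * exp k + (b - ?c) * exp v)
      ((?c - a) + (b - ?c)) \<le> 0"
    unfolding defect_add using ab
    by (intro add_nonpos_nonpos defect_const_nonpos k) auto
  moreover have "(?c - a) + (b - ?c) = b - a" by simp
  ultimately show ?thesis unfolding below_curve_def by metis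
qed

lemma moments_unique:
  "moments \<phi> a b P R \<Longrightarrow> moments \<phi> a b P' R' \<Longrightarrow> P = P' \<and> R = R'"
  by (simp add: moments_def)

lemma moments_subinterval:
  assumes "moments \<phi> l r P R" "l \<le> a" "a \<le> b" "b \<le> r"
  shows "\<exists>P R. moments \<phi> a b P R"
  using assms unfolding moments_def by (auto intro: absolutely_integrable_on_subinterval)

lemma below_curve_remove_both:
  assumes \<phi>: "moments \<phi> l r P R" "defect C m P R (r - l) \<le> 0"
    and left: "moments \<phi> l a P1 R1" "0 \<le> defect C m P1 R1 (a - l)"
    and right: "moments \<phi> b r P2 R2" "0 \<le> defect C m P2 R2 (r - b)"
    and ab: "a \<le> b"
  shows "below_curve C \<phi> a b"
proof -
  have "l \<le> a" "b \<le> r" using left(1) right(1) by (auto simp: moments_def)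
  then obtain P3 R3 where mid: "moments \<phi> a b P3 R3"
    using moments_subinterval[OF \<phi>(1)] ab by blast
  have "P1 + P3 + P2 = P \<and> R1 + R3 + R2 = R"
    by (rule moments_unique[OF moments_combine[OF moments_combine[OF left(1) mid] right(1)] \<phi>(1)])
  then have "defect C m P R ((a - l) + (b - a) + (r - b)) =
      defect C m P1 R1 (a - l) + defect C m P3 R3 (b - a) + defect C m P2 R2 (r - b)"
    by (metis defect_add)
  moreover have "(a - l) + (b - a) + (r - b) = r - l" by simp
  ultimately have "defect C m P3 R3 (b - a) \<le> 0" using \<phi>(2) left(2) right(2) by simp
  with mid show ?thesis unfolding below_curve_def by blast
qed

text \<open>The chord joining the points of the lower boundary over \<open>k\<close> and over
  \<open>k + \<xi>\<^sup>- - \<xi>\<^sup>+\<close> is tangent to the upper boundary at \<open>x1 = k + \<xi>\<^sup>-\<close>.\<close>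

lemma exp_tangent_chord:
  assumes C: "1 \<le> C"
  shows "exp (k + xi_minus C - xi_plus C) = exp k * (1 - xi_plus C) / (1 - xi_minus C)"
  using exp_root[OF C, of "xi_plus C"] exp_root[OF C, of "xi_minus C"]
    xi_plus_root[OF C] xi_minus_root[OF C] C
  by (simp add: exp_add exp_diff)

lemma two_values_E_class:
  assumes C: "1 \<le> C"
    and lr: "l < r" "{l<..<r} \<subseteq> Q" "Q \<subseteq> {l..r}"
    and v: "lam + xi_minus C - xi_plus C \<le> v" "v \<le> lam" and \<theta>: "0 \<le> \<theta>" "\<theta> \<le> 1"
    and x: "x1 = \<theta> * lam + (1 - \<theta>) * v" "x2 = \<theta> * exp lam + (1 - \<theta>) * exp v"
  shows "(\<lambda>t. if t \<le> l + \<theta> * (r - l) then lam else v) \<in> E_class (x1, x2) C Q"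
proof (rule E_classI[OF C lr])
  let ?c = "l + \<theta> * (r - l)" and ?\<phi> = "\<lambda>t. if t \<le> l + \<theta> * (r - l) then lam else v"
  have "\<theta> * (r - l) \<le> r - l"
    using \<theta> lr(1) by (intro mult_left_le_one_le) auto
  then have "?c \<le> r" by (simp only: le_diff_eq add.commute)
  moreover have "l \<le> ?c" using \<theta> lr(1) by simp
  ultimately have c: "l \<le> ?c" "?c \<le> r" by blast+
  have "moments ?\<phi> l ?c ((?c - l) * lam) ((?c - l) * exp lam)"
    "moments ?\<phi> ?c r ((r - ?c) * v) ((r - ?c) * exp v)"
    by (rule moments_const; use c in auto)+
  from moments_combine[OF this]
  show "moments ?\<phi> l r ((r - l) * x1) ((r - l) * x2)"
    by (simp add: x algebra_simps)
  let ?m = "lam + xi_minus C"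
  show "below_curve C ?\<phi> a b" if "l \<le> a" "a < b" "b \<le> r" for a b
  proof (rule two_values_below[OF that(2), where k = lam and m = ?m and v = v and c = ?c])
    show "exp (lam - ?m) \<le> C * (1 + (lam - ?m))" "exp (v - ?m) \<le> C * (1 + (v - ?m))"
      using v xi_plus_root[OF C] xi_minus_root[OF C]
        tangent_sign(3)[OF C, of "lam - ?m"] tangent_sign(3)[OF C, of "v - ?m"] by linarith+
  qed auto
qed

lemma log_step_E_class:
  assumes C: "1 < C"
    and lr: "l < r" "{l<..<r} \<subseteq> Q" "Q \<subseteq> {l..r}"
    and ab: "0 \<le> \<alpha>" "0 \<le> \<beta>" "\<alpha> + \<beta> \<le> 1"
  defines "\<xi> \<equiv> xi_plus C" and "\<eta> \<equiv> xi_minus C"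
  assumes x: "x1 = lam + \<alpha> * \<xi> + \<beta> * \<eta>"
      "x2 = exp lam * (1 + \<alpha> * \<xi> / (1 - \<xi>) + \<beta> * \<eta> / (1 - \<eta>))"
    and le: "x2 \<le> C * exp x1"
  defines "A \<equiv> \<alpha> * (r - l)" and "c \<equiv> r - \<beta> * (- \<eta> / (\<xi> - \<eta>)) * (r - l)" and "w \<equiv> lam + \<eta> - \<xi>"
  shows "log_step l lam \<xi> A c w \<in> E_class (x1, x2) C Q"
    and "l + A \<le> c" "c \<le> r"
    and "moments (log_step l lam \<xi> A c w) l c (A * (lam + \<xi>) + (c - l - A) * lam)
          (A * (exp lam / (1 - \<xi>)) + (c - l - A) * exp lam)"
proof -
  have C1: "1 \<le> C" using C by simp
  have \<xi>: "0 \<le> \<xi>" "\<xi> < 1" "kap \<xi> = 1 / C" "\<eta> \<le> 0" "kap \<eta> = 1 / C"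
    using xi_plus_root[OF C1] xi_minus_root[OF C1] by (auto simp: \<xi>_def \<eta>_def)
  have nz: "0 < \<xi>" "\<eta> < 0"
    using root_nonzero[OF C] \<xi> by (auto simp: less_le)
  let ?\<phi> = "log_step l lam \<xi> A c w"
  have q: "(r - c) * (\<xi> - \<eta>) = - \<beta> * \<eta> * (r - l)"
    using nz by (simp add: c_def)
  have A: "0 \<le> A" using ab lr by (simp add: A_def)
  show cr: "c \<le> r"
  proof -
    have g: "0 \<le> \<beta> * (- \<eta> / (\<xi> - \<eta>))"
      using ab nz by (intro mult_nonneg_nonneg divide_nonneg_nonneg) auto
    have "0 \<le> \<beta> * (- \<eta> / (\<xi> - \<eta>)) * (r - l)"
      by (rule mult_nonneg_nonneg[OF g]) (use lr in simp)
    then show ?thesis unfolding c_def by linarith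
  qed
  have "- \<eta> / (\<xi> - \<eta>) \<le> 1" using nz by (subst divide_le_eq_1_pos) auto
  then have "\<beta> * (- \<eta> / (\<xi> - \<eta>)) \<le> \<beta> * 1" using ab by (intro mult_left_mono) auto
  then have "(\<alpha> + \<beta> * (- \<eta> / (\<xi> - \<eta>))) * (r - l) \<le> 1 * (r - l)"
    using ab lr by (intro mult_right_mono) auto
  then show Ac: "l + A \<le> c" by (simp add: A_def c_def algebra_simps)
  show head: "moments ?\<phi> l c (A * (lam + \<xi>) + (c - l - A) * lam)
          (A * (exp lam / (1 - \<xi>)) + (c - l - A) * exp lam)"
    using A Ac \<xi> by (intro log_step_moments_head) auto
  have tail: "moments ?\<phi> b r ((r - b) * w) ((r - b) * exp w)" if "c \<le> b" "b \<le> r" for b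
    using that A Ac by (intro moments_const) (auto simp: log_step_def)
  have P: "A * (lam + \<xi>) + (c - l - A) * lam + (r - c) * w = (r - l) * x1"
  proof -
    have "A * (lam + \<xi>) + (c - l - A) * lam + (r - c) * w = (r - l) * lam + A * \<xi> - (r - c) * (\<xi> - \<eta>)"
      by (simp add: w_def algebra_simps)
    then show ?thesis unfolding q by (simp add: x A_def algebra_simps)
  qed
  have R: "A * (exp lam / (1 - \<xi>)) + (c - l - A) * exp lam + (r - c) * exp w = (r - l) * x2"
  proof -
    have 1: "1 / (1 - \<xi>) = 1 + \<xi> / (1 - \<xi>)" "(1 - \<xi>) / (1 - \<eta>) = 1 - (\<xi> - \<eta>) / (1 - \<eta>)"
      using nz \<xi>(2) by (simp_all add: field_simps)
    have "exp w = exp lam * ((1 - \<xi>) / (1 - \<eta>))"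
      unfolding w_def \<xi>_def \<eta>_def exp_tangent_chord[OF C1] by simp
    then have "A * (exp lam / (1 - \<xi>)) + (c - l - A) * exp lam + (r - c) * exp w =
        exp lam * (A * (1 / (1 - \<xi>)) + (c - l - A) + (r - c) * ((1 - \<xi>) / (1 - \<eta>)))"
      by (simp add: algebra_simps)
    also have "\<dots> = exp lam * ((r - l) + A * (\<xi> / (1 - \<xi>)) - (r - c) * (\<xi> - \<eta>) / (1 - \<eta>))"
      unfolding 1 by (simp add: algebra_simps)
    also have "\<dots> = (r - l) * x2"
      unfolding q by (simp add: x A_def divide_inverse algebra_simps)
    finally show ?thesis .
  qed
  have total: "moments ?\<phi> l r ((r - l) * x1) ((r - l) * x2)"
    using moments_combine[OF head tail[OF order_refl cr]] unfolding P R .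
  show "?\<phi> \<in> E_class (x1, x2) C Q"
  proof (rule E_classI[OF C1 lr total])
    fix a b assume h: "l \<le> a" "a < b" "b \<le> r"
    consider "b \<le> c" | "l + A \<le> a" | "c < b" "a < l + A" by linarith
    then show "below_curve C ?\<phi> a b"
    proof cases
      case 1
      then show ?thesis
        using log_step_head_below[OF C1 \<xi>(3,2) A Ac h(1,2)] by simp
    next
      case 2
      let ?m = "lam + \<eta>"
      show ?thesis
      proof (rule two_values_below[OF h(2), where k = lam and m = ?m and v = w and c = c])
        show "exp (lam - ?m) \<le> C * (1 + (lam - ?m))" "exp (w - ?m) \<le> C * (1 + (w - ?m))"
          using \<xi>(3,5) unfolding root_iff_kap[OF C1, symmetric] by (simp_all add: w_def)
      qed (use 2 A in \<open>auto simp: log_step_def\<close>)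
    next
      case 3
      obtain P' R' where left: "moments ?\<phi> l a P' R'" "\<And>m. 0 \<le> defect C m P' R' (a - l)"
        using log_step_left_nonneg[OF C1 \<xi>(3,2) h(1), where \<alpha> = A and u = lam and c = c and v = w] 3
        by auto
      have "\<beta> * \<eta> \<ge> 1 * \<eta>" using ab nz by (intro mult_right_mono_neg) auto
      moreover have "0 \<le> \<alpha> * \<xi>" using ab \<xi> by simp
      ultimately have "w - x1 \<le> - \<xi>" by (simp add: x w_def)
      then have "C * (1 + (w - x1)) \<le> exp (w - x1)"
        unfolding \<xi>_def by (rule tangent_sign(1)[OF C1])
      then have right: "0 \<le> defect C x1 ((r - b) * w) ((r - b) * exp w) (r - b)"
        using h by (intro defect_const_nonneg) auto
      have "(r - l) * (x2 - C * exp x1) \<le> 0"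
        using le lr by (intro mult_nonneg_nonpos) auto
      then have "defect C x1 ((r - l) * x1) ((r - l) * x2) (r - l) \<le> 0"
        by (simp add: defect_def algebra_simps)
      from below_curve_remove_both[OF total this left tail right] show ?thesis
        using h 3 by simp
    qed
  qed
qed

lemma log_step_le:
  assumes "0 \<le> \<xi>" "0 < \<rho>" "\<rho> \<le> \<alpha>" "l + \<rho> < t" "t \<le> c"
  shows "log_step l u \<xi> \<alpha> c v t \<le> u + \<xi> * ln (\<alpha> / \<rho>)"
proof (cases "t \<le> l + \<alpha>")
  case True
  have "ln (\<alpha> / (t - l)) \<le> ln (\<alpha> / \<rho>)" using assms by (simp add: frac_le)
  then have "\<xi> * ln (\<alpha> / (t - l)) \<le> \<xi> * ln (\<alpha> / \<rho>)" using assms(1) by (rule mult_left_mono)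
  then show ?thesis using True by (simp add: log_step_def)
next
  case False
  then show ?thesis using assms by (simp add: log_step_def)
qed

lemma step_log_E_class:
  fixes C l r u \<alpha> \<rho> lam :: real and Q :: "real set"
  assumes C: "1 < C"
    and lr: "l < r" "{l<..<r} \<subseteq> Q" "Q \<subseteq> {l..r}"
  defines "\<xi> \<equiv> xi_plus C" and "\<eta> \<equiv> xi_minus C"
  defines "w \<equiv> lam + \<eta> - \<xi>"
  assumes \<rho>: "0 < \<rho>" "\<rho> \<le> \<alpha>" "l + \<alpha> \<le> r" "u + \<xi> * ln (\<alpha> / \<rho>) = w"
  defines "c \<equiv> l + \<rho> * (\<xi> / (\<xi> - \<eta>))" and "\<psi> \<equiv> log_step l u \<xi> \<alpha> r 0"
  assumes x: "(r - l) * x1 = \<alpha> * (u + \<xi>) + (r - l - \<alpha>) * u"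
      "(r - l) * x2 = \<alpha> * (exp u / (1 - \<xi>)) + (r - l - \<alpha>) * exp u"
  shows "(\<lambda>t. if t \<le> c then lam else if t \<le> l + \<rho> then w else \<psi> t) \<in> E_class (x1, x2) C Q"
    (is "?\<phi> \<in> _")
    and "l \<le> c" "c \<le> r"
proof -
  have C1: "1 \<le> C" using C by simp
  have \<xi>: "0 \<le> \<xi>" "\<xi> < 1" "kap \<xi> = 1 / C" "\<eta> \<le> 0" "kap \<eta> = 1 / C"
    using xi_plus_root[OF C1] xi_minus_root[OF C1] by (auto simp: \<xi>_def \<eta>_def)
  have nz: "0 < \<xi>" "\<eta> < 0"
    using root_nonzero[OF C] \<xi> by (auto simp: less_le)
  have q: "(c - l) * (\<xi> - \<eta>) = \<rho> * \<xi>" using nz by (simp add: c_def)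
  show lc: "l \<le> c" using nz \<rho> by (simp add: c_def)
  have "\<rho> * (\<xi> / (\<xi> - \<eta>)) \<le> \<rho> * 1" using nz \<rho> by (intro mult_left_mono) auto
  then have c\<rho>: "c \<le> l + \<rho>" by (simp add: c_def)
  then show "c \<le> r" using \<rho> by simp
  have m1: "moments ?\<phi> l a ((a - l) * lam) ((a - l) * exp lam)" if "l \<le> a" "a \<le> c" for a
    using that by (intro moments_const) auto
  have m2: "moments ?\<phi> l a ((c - l) * lam + (a - c) * w) ((c - l) * exp lam + (a - c) * exp w)"
    if "c \<le> a" "a \<le> l + \<rho>" for a
    using that by (intro moments_combine[OF m1[OF lc order_refl]] moments_const) auto
  have P: "(c - l) * lam + (l + \<rho> - c) * w = \<rho> * (w + \<xi>)"
  proof -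
    have "(c - l) * lam + (l + \<rho> - c) * w = \<rho> * w + (c - l) * (\<xi> - \<eta>)"
      by (simp add: w_def algebra_simps)
    then show ?thesis unfolding q by (simp add: algebra_simps)
  qed
  have R: "(c - l) * exp lam + (l + \<rho> - c) * exp w = \<rho> * (exp w / (1 - \<xi>))"
  proof -
    have 1: "1 / (1 - \<xi>) = 1 + \<xi> / (1 - \<xi>)" "(1 - \<eta>) / (1 - \<xi>) = 1 + (\<xi> - \<eta>) / (1 - \<xi>)"
      using nz \<xi>(2) by (simp_all add: field_simps)
    have "exp w * (1 - \<eta>) = exp lam * (1 - \<xi>)"
      using exp_tangent_chord[OF C1, of lam] nz by (simp add: w_def \<xi>_def \<eta>_def)
    then have "exp lam = exp w * ((1 - \<eta>) / (1 - \<xi>))" using \<xi>(2) by (simp add: field_simps)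
    then have "(c - l) * exp lam + (l + \<rho> - c) * exp w =
        exp w * ((c - l) * ((1 - \<eta>) / (1 - \<xi>)) + (l + \<rho> - c))"
      by (simp add: algebra_simps)
    also have "\<dots> = exp w * (\<rho> + (c - l) * (\<xi> - \<eta>) / (1 - \<xi>))"
      unfolding 1 by (simp add: algebra_simps)
    also have "\<dots> = exp w * (\<rho> * (1 / (1 - \<xi>)))"
      unfolding q 1 by (simp add: algebra_simps)
    finally show ?thesis by simp
  qed
  have \<psi>\<rho>: "\<psi> (l + \<rho>) = w" using \<rho> by (simp add: \<psi>_def log_step_def)
  have "moments \<psi> l (l + \<rho>) (\<rho> * (w + \<xi>)) (\<rho> * (exp w / (1 - \<xi>)))"
    using log_step_moments_log[of l "l + \<rho>" \<alpha> \<xi> u r 0] \<rho> \<xi>(2) \<psi>\<rho> by (simp add: \<psi>_def)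
  moreover have \<phi>\<rho>: "moments ?\<phi> l (l + \<rho>) (\<rho> * (w + \<xi>)) (\<rho> * (exp w / (1 - \<xi>)))"
    using m2[OF c\<rho> order_refl] unfolding P R .
  ultimately have m3: "moments ?\<phi> l b P R" if "moments \<psi> l b P R" "l + \<rho> \<le> b" for b P R
  proof -
    have "moments ?\<phi> (l + \<rho>) b (P - \<rho> * (w + \<xi>)) (R - \<rho> * (exp w / (1 - \<xi>)))"
      by (rule moments_cong[OF moments_split[OF that(1) _ that(2)]])
        (use \<open>moments \<psi> l (l + \<rho>) _ _\<close> c\<rho> in auto)
    from moments_combine[OF \<phi>\<rho> this] show ?thesis by simp
  qed
  show "?\<phi> \<in> E_class (x1, x2) C Q"
  proof (rule E_classI[OF C1 lr])
    have "moments \<psi> l r ((r - l) * x1) ((r - l) * x2)"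
      unfolding x \<psi>_def using \<rho> \<xi> by (intro log_step_moments_head) auto
    then show "moments ?\<phi> l r ((r - l) * x1) ((r - l) * x2)" using m3 \<rho> by simp
    fix a b assume h: "l \<le> a" "a < b" "b \<le> r"
    consider "l + \<rho> \<le> a" | "b \<le> l + \<rho>" | "a < l + \<rho>" "l + \<rho> < b" by linarith
    then show "below_curve C ?\<phi> a b"
    proof cases
      case 1
      have "below_curve C \<psi> a b"
        unfolding \<psi>_def using \<rho> h \<xi> by (intro log_step_head_below C1) auto
      then show ?thesis by (rule below_curve_cong) (use 1 c\<rho> in auto)
    next
      case 2
      let ?m = "lam + \<eta>"
      show ?thesis
      proof (rule two_values_below[OF h(2), where k = lam and m = ?m and v = w and c = c])
        show "exp (lam - ?m) \<le> C * (1 + (lam - ?m))" "exp (w - ?m) \<le> C * (1 + (w - ?m))"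
          using \<xi>(3,5) unfolding root_iff_kap[OF C1, symmetric] by (simp_all add: w_def)
      qed (use 2 in auto)
    next
      case 3
      let ?m = "\<psi> b + \<xi>"
      obtain P R where \<psi>b: "moments \<psi> l b P R" "defect C ?m P R (b - l) = 0"
        using log_step_head_zero[OF C1 \<xi>(3,2), where \<alpha> = \<alpha> and l = l and b = b and c = r and u = u and v = 0]
          3 h \<rho> by (auto simp: \<psi>_def)
      have "\<psi> b \<le> w"
        unfolding \<psi>_def \<rho>(4)[symmetric] using 3 h \<rho> \<xi> by (intro log_step_le) auto
      then have "- \<eta> \<le> lam - ?m" by (simp add: w_def)
      then have lam: "C * (1 + (lam - ?m)) \<le> exp (lam - ?m)"
        unfolding \<eta>_def by (rule tangent_sign(2)[OF C1])
      have "\<exists>P' R'. moments ?\<phi> l a P' R' \<and> 0 \<le> defect C ?m P' R' (a - l)"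
      proof (cases "a \<le> c")
        case True
        then show ?thesis
          using m1[OF h(1) True] defect_const_nonneg[OF lam, of "a - l"] h(1) by auto
      next
        case False
        let ?K = "exp ?m * (exp (w - ?m) - C * (1 + (w - ?m)))"
        let ?A = "defect C ?m ((c - l) * lam) ((c - l) * exp lam) (c - l)"
        have split: "defect C ?m ((c - l) * lam + (t - c) * w) ((c - l) * exp lam + (t - c) * exp w) (t - l)
            = ?A + (t - c) * ?K" for t
          using defect_add[of C ?m "(c - l) * lam" "(t - c) * w" "(c - l) * exp lam" "(t - c) * exp w" "c - l" "t - c"]
          unfolding defect_const by simp
        have "0 \<le> ?A" using lam lc by (intro defect_const_nonneg) auto
        moreover have "0 \<le> ?A + (l + \<rho> - c) * ?K"
          using defect_log_nonneg[OF C1 \<xi>(3), of \<rho> ?m w] \<rho>(1) split[of "l + \<rho>"] unfolding P R by simp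
        moreover have "min 0 ((l + \<rho> - c) * ?K) \<le> (a - c) * ?K"
        proof (cases "0 \<le> ?K")
          case True
          then have "0 \<le> (a - c) * ?K" using mult_nonneg_nonneg[of "a - c" ?K] False by simp
          then show ?thesis by simp
        next
          case K: False
          then have "(l + \<rho> - c) * ?K \<le> (a - c) * ?K" using 3 by (intro mult_right_mono_neg) auto
          then show ?thesis by (rule min.coboundedI2)
        qed
        ultimately have "0 \<le> ?A + (a - c) * ?K" by (smt (verit))
        then show ?thesis using m2[of a] split[of a] False 3 by fastforce
      qed
      then show ?thesis
        using below_curve_remove_left[OF m3[OF \<psi>b(1)], where m = ?m and C = C and a = a] \<psi>b(2) 3 h by auto
    qed
  qed
qed

section \<open>Powers of logarithms\<close>

lemma abs_powr_le: "p \<le> 2 \<Longrightarrow> 0 < p \<Longrightarrow> \<bar>y::real\<bar> powr p \<le> 1 + y\<^sup>2"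
proof (cases "\<bar>y\<bar> \<le> 1")
  case True
  assume "0 < p"
  then have "\<bar>y\<bar> powr p \<le> 1 powr p" using True by (intro powr_mono2) auto
  then show ?thesis by (simp add: add_increasing2)
next
  case False
  assume "p \<le> 2"
  then have "\<bar>y\<bar> powr p \<le> \<bar>y\<bar> powr 2" using False by (intro powr_mono) auto
  also have "\<dots> = y\<^sup>2" using False by (simp add: powr_numeral)
  finally show ?thesis by simp
qed

lemma DERIV_abs_powr:
  fixes p y :: real
  assumes "1 < p"
  shows "((\<lambda>y. \<bar>y\<bar> powr p) has_real_derivative p * (\<bar>y\<bar> powr (p - 1) * sgn y)) (at y)"
proof -
  consider "0 < y" | "y < 0" | "y = 0" by linarith
  then show ?thesis
  proof cases
    case 1
    have "\<forall>\<^sub>F z in nhds y. z \<in> {0<..}" using 1 by (intro eventually_nhds_in_open) auto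
    then have "\<forall>\<^sub>F z in nhds y. \<bar>z\<bar> powr p = z powr p" by (rule eventually_mono) simp
    moreover have "((\<lambda>y. y powr p) has_real_derivative p * (\<bar>y\<bar> powr (p - 1) * sgn y)) (at y)"
      using has_real_derivative_powr[OF 1, of p] 1 by simp
    ultimately show ?thesis by (subst DERIV_cong_ev) auto
  next
    case 2
    have "\<forall>\<^sub>F z in nhds y. z \<in> {..<0}" using 2 by (intro eventually_nhds_in_open) auto
    then have "\<forall>\<^sub>F z in nhds y. \<bar>z\<bar> powr p = (- z) powr p" by (rule eventually_mono) simp
    moreover have "((\<lambda>y. (- y) powr p) has_real_derivative p * (- y) powr (p - 1) * - 1) (at y)"
      using 2 by (intro DERIV_chain2[OF has_real_derivative_powr] derivative_eq_intros) auto
    ultimately show ?thesis using 2 by (subst DERIV_cong_ev) auto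
  next
    case 3
    have "((\<lambda>h. \<bar>h\<bar> powr (p - 1)) \<longlongrightarrow> \<bar>0\<bar> powr (p - 1)) (at (0::real))"
      using assms by (intro tendsto_powr' tendsto_intros) auto
    then have 0: "((\<lambda>h. \<bar>h\<bar> powr (p - 1)) \<longlongrightarrow> 0) (at (0::real))" by simp
    have "norm (\<bar>h\<bar> powr p / h) = \<bar>h\<bar> powr (p - 1)" if "h \<noteq> 0" for h :: real
      using that by (simp add: powr_diff)
    then have "((\<lambda>h::real. norm (\<bar>h\<bar> powr p / h)) \<longlongrightarrow> 0) (at 0)"
      by (intro Lim_transform_eventually[OF 0]) (simp add: eventually_at_filter)
    then have "((\<lambda>h::real. \<bar>h\<bar> powr p / h) \<longlongrightarrow> 0) (at 0)"
      by (rule tendsto_norm_zero_cancel)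
    then show ?thesis using 3 by (simp add: DERIV_def)
  qed
qed

context
  fixes p \<xi> :: real
  assumes p: "1 < p" "p \<le> 2" and \<xi>: "0 < \<xi>"
begin

private definition g :: "real \<Rightarrow> real" where
  "g s = \<bar>s\<bar> powr (p - 1) * sgn s * exp (- s / \<xi>)"

private lemma continuous_g: "continuous_on S g"
proof -
  have "continuous_on S (\<lambda>s. (max s 0 powr (p - 1) - max (- s) 0 powr (p - 1)) * exp (- s / \<xi>))"
    using p \<xi> by (intro continuous_intros continuous_on_powr') auto
  moreover have "(max s 0 powr (p - 1) - max (- s) 0 powr (p - 1)) * exp (- s / \<xi>) = g s" for s
    by (cases "s > 0"; cases "s = 0") (auto simp: g_def max_def)
  ultimately show ?thesis by simp
qed

private lemma g_bound:
  obtains K where "0 \<le> K" "\<And>s. a \<le> s \<Longrightarrow> norm (g s) \<le> K * exp (- (1 / (2 * \<xi>)) * s)"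
proof -
  let ?e = "\<lambda>s. exp (- (1 / (2 * \<xi>)) * s)"
  let ?K = "(1 + 2 * \<xi>) + (1 + \<bar>a\<bar>) * ?e a"
  have "norm (g s) \<le> ?K * ?e s" if "a \<le> s" for s
  proof -
    have "\<bar>s\<bar> powr (p - 1) \<le> 1 + \<bar>s\<bar>"
    proof (cases "\<bar>s\<bar> \<le> 1")
      case True
      then have "\<bar>s\<bar> powr (p - 1) \<le> 1 powr (p - 1)" using p by (intro powr_mono2) auto
      then show ?thesis by simp
    next
      case False
      then have "\<bar>s\<bar> powr (p - 1) \<le> \<bar>s\<bar> powr 1" using p by (intro powr_mono) auto
      then show ?thesis using False by simp
    qed
    moreover have "(1 + \<bar>s\<bar>) * ?e s \<le> ?K"
    proof (cases "0 \<le> s")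
      case True
      have "s / (2 * \<xi>) \<le> exp (s / (2 * \<xi>))"
        using exp_ge_add_one_self[of "s / (2 * \<xi>)"] by linarith
      then have "s \<le> 2 * \<xi> * exp (s / (2 * \<xi>))" using \<xi> by (simp add: pos_divide_le_eq mult.commute)
      moreover have "1 \<le> exp (s / (2 * \<xi>))" using True \<xi> by simp
      moreover have "(1 + 2 * \<xi>) * exp (s / (2 * \<xi>)) = exp (s / (2 * \<xi>)) + 2 * \<xi> * exp (s / (2 * \<xi>))"
        by (simp add: distrib_right)
      ultimately have "1 + \<bar>s\<bar> \<le> (1 + 2 * \<xi>) * exp (s / (2 * \<xi>))"
        using True by linarith
      then have "(1 + \<bar>s\<bar>) * ?e s \<le> (1 + 2 * \<xi>) * exp (s / (2 * \<xi>)) * ?e s"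
        by (rule mult_right_mono) simp
      also have "\<dots> = 1 + 2 * \<xi>" by (simp add: mult.assoc mult_exp_exp)
      finally show ?thesis by (simp add: add_increasing2)
    next
      case False
      then have "(1 + \<bar>s\<bar>) * ?e s \<le> (1 + \<bar>a\<bar>) * ?e a"
        using that \<xi> by (intro mult_mono) (auto simp: divide_right_mono)
      then show ?thesis using \<xi> by simp
    qed
    ultimately have "\<bar>s\<bar> powr (p - 1) * ?e s \<le> ?K"
      by (meson mult_right_mono exp_ge_zero order_trans)
    then have le: "\<bar>s\<bar> powr (p - 1) * ?e s * ?e s \<le> ?K * ?e s"
      by (rule mult_right_mono) simp
    have "\<bar>sgn s\<bar> \<le> 1" by (simp add: sgn_if)
    then have "norm (g s) \<le> \<bar>s\<bar> powr (p - 1) * 1 * exp (- s / \<xi>)"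
      unfolding g_def by (simp add: abs_mult mult_left_le)
    also have "\<dots> = \<bar>s\<bar> powr (p - 1) * ?e s * ?e s"
      by (simp add: mult_exp_exp mult.assoc)
    finally show ?thesis using le by (rule order_trans)
  qed
  moreover have "0 \<le> ?K" using \<xi> by simp
  ultimately show ?thesis using that by blast
qed

private lemma exp_tail:
  "((\<lambda>s. K * exp (- (1 / (2 * \<xi>)) * s)) has_integral K * (2 * \<xi> * exp (- (1 / (2 * \<xi>)) * a))) {a..}"
  using has_integral_mult_right[OF has_integral_exp_minus_to_infinity[of "1 / (2 * \<xi>)" a], of K] \<xi>
  by (simp add: mult.commute)

private lemma g_absolutely_integrable: "g absolutely_integrable_on {a..}"
proof -
  obtain K where K: "\<And>s. a \<le> s \<Longrightarrow> norm (g s) \<le> K * exp (- (1 / (2 * \<xi>)) * s)"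
    using g_bound[of a] by blast
  show ?thesis
  proof (rule measurable_bounded_by_integrable_imp_absolutely_integrable)
    show "g \<in> borel_measurable (lebesgue_on {a..})"
      by (intro continuous_imp_measurable_on_sets_lebesgue continuous_g) simp
    show "(\<lambda>s. K * exp (- (1 / (2 * \<xi>)) * s)) integrable_on {a..}"
      using exp_tail by (rule has_integral_integrable)
  qed (use K in auto)
qed

private lemma tail_eq: "(LBINT s:{a..}. g s) = integral {a..} g"
proof -
  have "g \<in> borel_measurable borel"
    using continuous_g[of UNIV] by (rule borel_measurable_continuous_onI)
  then have "set_integrable lborel {a..} g"
    using g_absolutely_integrable[of a] unfolding set_integrable_def
    by (subst (asm) integrable_completion) auto
  then show ?thesis by (rule set_borel_integral_eq_integral(2))
qed

private lemma tail_split: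
  assumes "a \<le> b"
  shows "integral {a..} g = integral {a..b} g + integral {b..} g"
proof -
  have "(g has_integral integral {a..b} g + integral {b..} g) ({a..b} \<union> {b..})"
  proof (rule has_integral_Un)
    show "(g has_integral integral {a..b} g) {a..b}"
      by (intro integrable_integral integrable_continuous_real continuous_g)
    show "(g has_integral integral {b..} g) {b..}"
      using g_absolutely_integrable[of b] by (intro integrable_integral set_lebesgue_integral_eq_integral(1))
    have "{a..b} \<inter> {b..} \<subseteq> {b}" by auto
    then show "negligible ({a..b} \<inter> {b..})" by (rule negligible_subset[rotated]) simp
  qed
  moreover have "{a..b} \<union> {b..} = {a..}" using assms by auto
  ultimately show ?thesis by (simp add: integral_unique)
qed

lemma log_powr_has_integral:
  fixes l u s :: real
  assumes s: "0 < s"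
  shows "((\<lambda>t. \<bar>u + \<xi> * ln (s / (t - l))\<bar> powr p) has_integral
    s * (\<bar>u\<bar> powr p + p * exp (u / \<xi>) *
      (LBINT s:{u..}. \<bar>s\<bar> powr (p - 1) * sgn s * exp (- s / \<xi>)))) {l..l + s}"
proof -
  let ?y = "\<lambda>t. u + \<xi> * ln (s / (t - l))" and ?a = "u - 1" and ?k = "p * s * exp (u / \<xi>)"
  let ?I = "\<lambda>y. integral {?a..y} g"
  let ?G = "\<lambda>t. (t - l) * \<bar>?y t\<bar> powr p - ?k * ?I (?y t)"
  let ?L = "0 - ?k * (integral {?a..} g - 0)"
  have yu: "u \<le> ?y t" if "l < t" "t \<le> l + s" for t
    using that s \<xi> by simp
  have I: "(?I has_real_derivative g y) (at y)" if "u \<le> y" for y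
  proof -
    have "(?I has_real_derivative g y) (at y within {?a..y + 1})"
      by (rule integral_has_real_derivative[OF continuous_g]) (use that in auto)
    moreover have "at y within {?a..y + 1} = at y"
      using that by (intro at_within_interior) simp
    ultimately show ?thesis by simp
  qed
  have "((\<lambda>t. \<bar>?y t\<bar> powr p) has_integral (?G (l + s) - ?L)) {l..l + s}"
  proof (rule has_integral_left_limit)
    fix t assume t: "l < t" "t \<le> l + s"
    let ?d = "\<bar>?y t\<bar> powr (p - 1) * sgn (?y t)"
    note dy = DERIV_log[OF s t(1), of u \<xi>]
    have E: "exp (- ?y t / \<xi>) = exp (- u / \<xi>) * ((t - l) / s)"
    proof -
      have "- ?y t / \<xi> = - u / \<xi> + ln ((t - l) / s)"
        using \<xi> s t by (simp add: ln_div field_simps)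
      then have "exp (- ?y t / \<xi>) = exp (- u / \<xi>) * exp (ln ((t - l) / s))"
        by (simp only: exp_add)
      then show ?thesis using s t by simp
    qed
    have "?k * g (?y t) = p * ?d * (t - l) * (exp (u / \<xi>) * exp (- u / \<xi>))"
      unfolding g_def E using s by simp
    then have k: "?k * g (?y t) = p * ?d * (t - l)" by (simp add: mult_exp_exp)
    have "(?G has_real_derivative
        ((1 - 0) * \<bar>?y t\<bar> powr p + p * ?d * (- \<xi> / (t - l)) * (t - l)) -
        ?k * (g (?y t) * (- \<xi> / (t - l)))) (at t)"
      by (intro DERIV_diff DERIV_mult DERIV_ident DERIV_const DERIV_cmult
          DERIV_chain2[OF DERIV_abs_powr[OF p(1)] dy] DERIV_chain2[OF I[OF yu[OF t]] dy])
    moreover have "?k * (g (?y t) * (- \<xi> / (t - l))) = p * ?d * (- \<xi> / (t - l)) * (t - l)"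
      unfolding mult.assoc[symmetric] k by (simp add: mult.commute mult.left_commute)
    ultimately show "(?G has_real_derivative \<bar>?y t\<bar> powr p) (at t)" by simp
  next
    have ev: "\<forall>\<^sub>F t in at_right l. l < t \<and> t \<le> l + s"
      using eventually_at_right_less[of l] eventually_at_right_field[of _ l] s
      by (auto simp: eventually_at_right_field intro!: exI[of _ "l + s"])
    have "((\<lambda>t. (t - l) + (t - l) * (?y t)\<^sup>2) \<longlongrightarrow> 0 + 0) (at_right l)"
      by (intro tendsto_add log_powers_tendsto_0 log_square_tendsto_0 s)
    then have sq: "((\<lambda>t. (t - l) + (t - l) * (?y t)\<^sup>2) \<longlongrightarrow> 0) (at_right l)" by simp
    have "((\<lambda>t. (t - l) * \<bar>?y t\<bar> powr p) \<longlongrightarrow> 0) (at_right l)"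
    proof (rule Lim_null_comparison[OF _ sq])
      show "\<forall>\<^sub>F t in at_right l. norm ((t - l) * \<bar>?y t\<bar> powr p) \<le> (t - l) + (t - l) * (?y t)\<^sup>2"
        using ev
      proof (rule eventually_mono)
        fix t assume "l < t \<and> t \<le> l + s"
        then show "norm ((t - l) * \<bar>?y t\<bar> powr p) \<le> (t - l) + (t - l) * (?y t)\<^sup>2"
          using mult_left_mono[OF abs_powr_le[OF p(2), of "?y t"], of "t - l"] p
          by (simp add: abs_mult distrib_left)
      qed
    qed
    moreover have "((\<lambda>t. integral {?y t..} g) \<longlongrightarrow> 0) (at_right l)"
    proof -
      obtain K where K: "\<And>s. u \<le> s \<Longrightarrow> norm (g s) \<le> K * exp (- (1 / (2 * \<xi>)) * s)"
        using g_bound[of u] by blast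
      let ?c = "K * (2 * \<xi> * exp (- u / (2 * \<xi>)) * s powr (- 1 / 2))"
      show ?thesis
      proof (rule Lim_null_comparison[rotated])
        show "((\<lambda>t. ?c * (t - l) powr (1 / 2)) \<longlongrightarrow> 0) (at_right l)"
          by (rule tendsto_mult_right_zero, rule log_powers_tendsto_0) simp
        show "\<forall>\<^sub>F t in at_right l. norm (integral {?y t..} g) \<le> ?c * (t - l) powr (1 / 2)"
          using ev
        proof (rule eventually_mono)
          fix t assume t: "l < t \<and> t \<le> l + s"
          have "norm (integral {?y t..} g) \<le> integral {?y t..} (\<lambda>s. K * exp (- (1 / (2 * \<xi>)) * s))"
          proof (rule integral_norm_bound_integral)
            show "g integrable_on {?y t..}"
              using g_absolutely_integrable by (rule set_lebesgue_integral_eq_integral(1))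
            show "(\<lambda>s. K * exp (- (1 / (2 * \<xi>)) * s)) integrable_on {?y t..}"
              using exp_tail by (rule has_integral_integrable)
          qed (use K yu t in force)
          also have "\<dots> = K * (2 * \<xi> * exp (- (1 / (2 * \<xi>)) * ?y t))"
            using exp_tail by (rule integral_unique)
          also have "exp (- (1 / (2 * \<xi>)) * ?y t) = exp (- u / (2 * \<xi>)) * s powr (- 1 / 2) * (t - l) powr (1 / 2)"
          proof -
            have "- (1 / (2 * \<xi>)) * ?y t = - u / (2 * \<xi>) + (- 1 / 2) * ln s + 1 / 2 * ln (t - l)"
              using \<xi> s t by (simp add: ln_div field_simps)
            then have "exp (- (1 / (2 * \<xi>)) * ?y t) =
                exp (- u / (2 * \<xi>)) * exp ((- 1 / 2) * ln s) * exp (1 / 2 * ln (t - l))"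
              by (simp only: exp_add)
            then show ?thesis using s t by (simp add: powr_def)
          qed
          finally show "norm (integral {?y t..} g) \<le> ?c * (t - l) powr (1 / 2)"
            by (simp add: mult.assoc)
        qed
      qed
    qed
    ultimately have "((\<lambda>t. (t - l) * \<bar>?y t\<bar> powr p - ?k * (integral {?a..} g - integral {?y t..} g))
        \<longlongrightarrow> ?L) (at_right l)"
      by (intro tendsto_intros)
    moreover have "\<forall>\<^sub>F t in at_right l.
        (t - l) * \<bar>?y t\<bar> powr p - ?k * (integral {?a..} g - integral {?y t..} g) = ?G t"
      using ev
    proof (rule eventually_mono)
      fix t assume "l < t \<and> t \<le> l + s"
      then have "?a \<le> ?y t" using yu[of t] by linarith
      then show "(t - l) * \<bar>?y t\<bar> powr p - ?k * (integral {?a..} g - integral {?y t..} g) = ?G t"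
        using tail_split[of ?a "?y t"] by simp
    qed
    ultimately show "(?G \<longlongrightarrow> ?L) (at_right l)" by (rule Lim_transform_eventually)
  qed (use s in auto)
  moreover have "?G (l + s) - ?L = s * (\<bar>u\<bar> powr p + p * exp (u / \<xi>) * (LBINT s:{u..}. g s))"
    using s tail_split[of ?a u] by (simp add: tail_eq algebra_simps)
  ultimately show ?thesis by (simp add: g_def)
qed

end

section \<open>Values on the test functions\<close>

lemma E_class_has_integral:
  assumes lr: "l < r" "{l<..<r} \<subseteq> Q" "Q \<subseteq> {l..r}" and \<phi>: "\<phi> \<in> E_class (x1, x2) C Q"
  shows "(\<phi> has_integral (r - l) * x1) {l..r}"
proof -
  have i: "\<phi> absolutely_integrable_on Q" and av: "avg Q \<phi> = x1"
    using \<phi> by (auto simp: E_class_def)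
  have "(\<phi> has_integral integral Q \<phi>) Q"
    using i by (intro integrable_integral set_lebesgue_integral_eq_integral(1))
  moreover have "integral Q \<phi> = (r - l) * x1"
    using av measure_between(2)[of l r Q] lr
    by (simp add: avg_def set_lebesgue_integral_eq_integral(2)[OF i] field_simps)
  ultimately have I: "(\<phi> has_integral (r - l) * x1) Q" by simp
  show ?thesis
    by (rule iffD1[OF has_integral_spike_set_eq I]) (rule negligible_between[OF lr(2,3)])+
qed

lemma const_E_class:
  assumes C: "1 \<le> C" and lr: "l < r" "{l<..<r} \<subseteq> Q" "Q \<subseteq> {l..r}"
  shows "(\<lambda>_. k) \<in> E_class (k, exp k) C Q"
  by (rule E_classI[OF C lr]) (use lr in \<open>auto intro: moments_const below_curve_const[OF C]\<close>)

lemma nn_avg_const: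
  assumes lr: "l < r" "{l<..<r} \<subseteq> Q" "Q \<subseteq> {l..r}" and "0 \<le> k"
  shows "nn_avg Q (\<lambda>_. k) = ereal k"
  using nn_avg_between[OF lr has_integral_const_real[of k l r]] assms by simp

lemma nn_avg_log_step:
  assumes lr: "l < r" "{l<..<r} \<subseteq> Q" "Q \<subseteq> {l..r}" and s: "0 \<le> s" "s \<le> 1"
    and I: "0 < s \<Longrightarrow> ((\<lambda>t. f (u + \<xi> * ln (s * (r - l) / (t - l)))) has_integral
      s * (r - l) * I) {l..l + s * (r - l)}"
    and nonneg: "\<And>y. 0 \<le> f y"
  shows "nn_avg Q (\<lambda>t. f (log_step l u \<xi> (s * (r - l)) r v t)) = ereal (s * I + (1 - s) * f u)"
proof -
  let ?\<alpha> = "s * (r - l)" and ?\<phi> = "log_step l u \<xi> (s * (r - l)) r v"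
  have "?\<alpha> \<le> r - l"
    using s lr(1) by (intro mult_left_le_one_le) auto
  then have le: "l + ?\<alpha> \<le> r" by (simp only: le_diff_eq add.commute)
  have \<alpha>: "0 \<le> ?\<alpha>" using s lr(1) by simp
  have "((\<lambda>t. f (?\<phi> t)) has_integral ?\<alpha> * I) {l..l + ?\<alpha>}"
  proof (cases "s = 0")
    case True
    then show ?thesis by (simp add: has_integral_refl)
  next
    case False
    then show ?thesis
      using I s by (intro has_integral_eq[OF _ I]) (auto simp: log_step_def)
  qed
  moreover have "((\<lambda>t. f (?\<phi> t)) has_integral (r - (l + ?\<alpha>)) * f u) {l + ?\<alpha>..r}"
  proof (rule has_integral_spike_finite[of "{l + ?\<alpha>}"])
    show "((\<lambda>_. f u) has_integral (r - (l + ?\<alpha>)) * f u) {l + ?\<alpha>..r}"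
      using has_integral_const_real[of "f u" "l + ?\<alpha>" r] le by simp
  qed (auto simp: log_step_def)
  ultimately have "((\<lambda>t. f (?\<phi> t)) has_integral ?\<alpha> * I + (r - (l + ?\<alpha>)) * f u) {l..r}"
    using \<alpha> le by (intro has_integral_combine[of l "l + ?\<alpha>"]) auto
  then have "nn_avg Q (\<lambda>t. f (?\<phi> t)) = ereal ((?\<alpha> * I + (r - (l + ?\<alpha>)) * f u) / (r - l))"
    by (rule nn_avg_between[OF lr]) (rule nonneg)
  also have "?\<alpha> * I + (r - (l + ?\<alpha>)) * f u = (s * I + (1 - s) * f u) * (r - l)"
    by (simp add: algebra_simps)
  finally show ?thesis using lr(1) by simp
qed

lemma nn_avg_abs:
  assumes lr: "l < r" "{l<..<r} \<subseteq> Q" "Q \<subseteq> {l..r}"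
    and "((\<lambda>t. \<bar>\<phi> t\<bar>) has_integral (r - l) * y) {l..r}"
  shows "nn_avg Q (\<lambda>t. \<bar>\<phi> t\<bar> powr 1) = ereal y"
  using nn_avg_between[OF lr assms(4)] lr(1) by simp

lemma log_step_bounds:
  assumes "l \<le> t" "0 \<le> \<alpha>"
  shows "t \<le> c \<Longrightarrow> 0 \<le> \<xi> \<Longrightarrow> u \<le> log_step l u \<xi> \<alpha> c v t"
    and "t \<le> c \<Longrightarrow> \<xi> \<le> 0 \<Longrightarrow> log_step l u \<xi> \<alpha> c v t \<le> u"
proof -
  have "0 \<le> ln (\<alpha> / (t - l))" if "t \<le> l + \<alpha>"
    using that assms by (cases "t = l") auto
  then show "t \<le> c \<Longrightarrow> 0 \<le> \<xi> \<Longrightarrow> u \<le> log_step l u \<xi> \<alpha> c v t"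
    "t \<le> c \<Longrightarrow> \<xi> \<le> 0 \<Longrightarrow> log_step l u \<xi> \<alpha> c v t \<le> u"
    by (auto simp: log_step_def mult_nonpos_nonneg)
qed

lemma times_exp_root:
  assumes "1 \<le> C" "kap \<xi> = 1 / C"
  shows "C * exp \<xi> = 1 / (1 - \<xi>)"
  unfolding exp_root(1)[OF assms] using assms(1) by simp

lemma u_plus_E_class:
  assumes C: "1 < C" and x: "(x1, x2) \<in> Omega C"
    and lr: "l < r" "{l<..<r} \<subseteq> Q" "Q \<subseteq> {l..r}"
  defines "u \<equiv> u_plus C (x1, x2)" and "\<xi> \<equiv> xi_plus C"
  defines "s \<equiv> (x1 - u) / \<xi>"
  shows "0 < \<xi>" "\<xi> < 1" "0 \<le> s" "s \<le> 1" "x1 = u + s * \<xi>"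
    "x2 = exp u * (s * \<xi> / (1 - \<xi>) + 1)"
    "log_step l u \<xi> (s * (r - l)) r 0 \<in> E_class (x1, x2) C Q"
proof -
  have C1: "1 \<le> C" using C by simp
  note \<xi> = xi_plus_root[OF C1, folded \<xi>_def]
  show p: "0 < \<xi>" "\<xi> < 1" using \<xi> root_nonzero[OF C, of \<xi>] by (auto simp: less_le)
  note u = u_plus_props[OF C1 x, folded u_def \<xi>_def]
  show s: "0 \<le> s" "s \<le> 1" using u p by (auto simp: s_def divide_le_eq)
  show x1: "x1 = u + s * \<xi>" using p by (simp add: s_def)
  show x2: "x2 = exp u * (s * \<xi> / (1 - \<xi>) + 1)" using u(1) p by (simp add: s_def)
  show "log_step l u \<xi> (s * (r - l)) r 0 \<in> E_class (x1, x2) C Q"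
    using \<xi> p by (intro log_E_class[OF C1 _ _ lr s x1 x2]) auto
qed

lemma u_minus_E_class:
  assumes C: "1 < C" and x: "(x1, x2) \<in> Omega C"
    and lr: "l < r" "{l<..<r} \<subseteq> Q" "Q \<subseteq> {l..r}"
  defines "u \<equiv> u_minus C (x1, x2)" and "\<xi> \<equiv> xi_minus C"
  defines "s \<equiv> (x1 - u) / \<xi>"
  shows "\<xi> < 0" "0 \<le> s" "s \<le> 1" "x1 = u + s * \<xi>"
    "log_step l u \<xi> (s * (r - l)) r 0 \<in> E_class (x1, x2) C Q"
proof -
  have C1: "1 \<le> C" using C by simp
  note \<xi> = xi_minus_root[OF C1, folded \<xi>_def]
  show p: "\<xi> < 0" using \<xi> root_nonzero[OF C, of \<xi>] by (auto simp: less_le)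
  note u = u_minus_props[OF C1 x, folded u_def \<xi>_def]
  show s: "0 \<le> s" "s \<le> 1"
    using u p by (auto simp: s_def divide_le_eq intro: divide_nonpos_neg)
  show x1: "x1 = u + s * \<xi>" using p by (simp add: s_def)
  have x2: "x2 = exp u * (s * \<xi> / (1 - \<xi>) + 1)" using u(1) p by (simp add: s_def)
  show "log_step l u \<xi> (s * (r - l)) r 0 \<in> E_class (x1, x2) C Q"
    using \<xi> p by (intro log_E_class[OF C1 _ _ lr s x1 x2]) auto
qed

text \<open>Barycentric coordinates in the triangle with vertex \<open>(0, 1)\<close> bounded by the two tangents
  to the upper boundary through this vertex.\<close>

lemma wedge_coordinates:
  assumes C: "1 < C"
  defines "\<xi> \<equiv> xi_plus C" and "\<eta> \<equiv> xi_minus C"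
  assumes X: "\<eta> \<le> X" "X \<le> \<xi>" "1 + Y \<le> C * exp X"
    and Y: "X / (1 - \<xi>) \<le> Y" "X / (1 - \<eta>) \<le> Y"
  obtains \<alpha> \<beta> where "0 \<le> \<alpha>" "0 \<le> \<beta>" "\<alpha> + \<beta> \<le> 1" "X = \<alpha> * \<xi> + \<beta> * \<eta>"
    "Y = \<alpha> * \<xi> / (1 - \<xi>) + \<beta> * \<eta> / (1 - \<eta>)"
proof -
  have C1: "1 \<le> C" using C by simp
  have \<xi>: "\<xi> < 1" "kap \<xi> = 1 / C" "kap \<eta> = 1 / C" "0 < \<xi>" "\<eta> < 0"
    using xi_plus_root[OF C1] xi_minus_root[OF C1] root_nonzero[OF C] by (auto simp: \<xi>_def \<eta>_def less_le)
  have nz: "\<xi> - \<eta> > 0" "1 - \<xi> > 0" "1 - \<eta> > 0" using \<xi> by auto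
  define \<alpha> where "\<alpha> = (1 - \<xi>) * (Y * (1 - \<eta>) - X) / (\<xi> * (\<xi> - \<eta>))"
  define \<beta> where "\<beta> = (1 - \<eta>) * (Y * (1 - \<xi>) - X) / (- \<eta> * (\<xi> - \<eta>))"
  have "X \<le> Y * (1 - \<xi>)" "X \<le> Y * (1 - \<eta>)" using Y nz by (simp_all add: pos_divide_le_eq)
  then have pos: "0 \<le> \<alpha>" "0 \<le> \<beta>"
    unfolding \<alpha>_def \<beta>_def using \<xi>(4,5) nz
    by (intro divide_nonneg_pos mult_nonneg_nonneg mult_pos_pos; linarith)+
  have a: "\<alpha> * \<xi> = (1 - \<xi>) * (Y * (1 - \<eta>) - X) / (\<xi> - \<eta>)"
    "\<beta> * \<eta> = - ((1 - \<eta>) * (Y * (1 - \<xi>) - X)) / (\<xi> - \<eta>)"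
    using \<xi> nz by (simp_all add: \<alpha>_def \<beta>_def field_simps)
  have eX: "X = \<alpha> * \<xi> + \<beta> * \<eta>"
  proof -
    have "\<alpha> * \<xi> + \<beta> * \<eta> = ((1 - \<xi>) * (Y * (1 - \<eta>) - X) - (1 - \<eta>) * (Y * (1 - \<xi>) - X)) / (\<xi> - \<eta>)"
      unfolding a by (simp add: diff_divide_distrib)
    also have "(1 - \<xi>) * (Y * (1 - \<eta>) - X) - (1 - \<eta>) * (Y * (1 - \<xi>) - X) = X * (\<xi> - \<eta>)"
      by (simp add: algebra_simps)
    finally show ?thesis using nz by simp
  qed
  have eY: "Y = \<alpha> * \<xi> / (1 - \<xi>) + \<beta> * \<eta> / (1 - \<eta>)"
  proof -
    have "\<alpha> * \<xi> / (1 - \<xi>) + \<beta> * \<eta> / (1 - \<eta>) = ((Y * (1 - \<eta>) - X) - (Y * (1 - \<xi>) - X)) / (\<xi> - \<eta>)"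
      unfolding a using nz by (simp add: diff_divide_distrib)
    also have "(Y * (1 - \<eta>) - X) - (Y * (1 - \<xi>) - X) = Y * (\<xi> - \<eta>)"
      by (simp add: algebra_simps)
    finally show ?thesis using nz by simp
  qed
  have "\<alpha> + \<beta> \<le> 1"
  proof -
    define \<tau> where "\<tau> = (X - \<eta>) / (\<xi> - \<eta>)"
    have \<tau>: "0 \<le> \<tau>" "\<tau> \<le> 1" "X = (1 - \<tau>) * \<eta> + \<tau> * \<xi>"
    proof -
      show "0 \<le> \<tau>" "\<tau> \<le> 1" using X nz by (auto simp: \<tau>_def divide_le_eq)
      have "\<tau> * (\<xi> - \<eta>) = X - \<eta>" using nz by (simp add: \<tau>_def)
      then show "X = (1 - \<tau>) * \<eta> + \<tau> * \<xi>" by (simp add: algebra_simps)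
    qed
    have "exp X \<le> (1 - \<tau>) * exp \<eta> + \<tau> * exp \<xi>"
      using convex_onD[OF exp_convex \<tau>(1,2), of \<eta> \<xi>] \<tau>(3) by simp
    then have "C * exp X \<le> C * ((1 - \<tau>) * exp \<eta> + \<tau> * exp \<xi>)"
      using C1 by (intro mult_left_mono) auto
    also have "\<dots> = (1 - \<tau>) * (C * exp \<eta>) + \<tau> * (C * exp \<xi>)"
      by (simp add: algebra_simps)
    also have "C * exp \<eta> = 1 + \<eta> / (1 - \<eta>)"
      unfolding times_exp_root[OF C1 \<xi>(3)] using nz by (simp add: field_simps)
    also have "C * exp \<xi> = 1 + \<xi> / (1 - \<xi>)"
      unfolding times_exp_root[OF C1 \<xi>(2)] using nz by (simp add: field_simps)
    finally have "1 + Y \<le> (1 - \<tau>) * (1 + \<eta> / (1 - \<eta>)) + \<tau> * (1 + \<xi> / (1 - \<xi>))"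
      using X(3) by linarith
    then have le: "(\<alpha> - \<tau>) * \<xi> / (1 - \<xi>) + (\<beta> - 1 + \<tau>) * \<eta> / (1 - \<eta>) \<le> 0"
      unfolding eY by (simp add: diff_divide_distrib add_divide_distrib algebra_simps)
    have eq: "(\<beta> - 1 + \<tau>) * \<eta> = - ((\<alpha> - \<tau>) * \<xi>)"
      using eX \<tau>(3) by (simp add: algebra_simps)
    have "(\<alpha> - \<tau>) * \<xi> * (1 / (1 - \<xi>) - 1 / (1 - \<eta>)) \<le> 0"
      using le unfolding eq by (simp add: right_diff_distrib)
    moreover have "0 < 1 / (1 - \<xi>) - 1 / (1 - \<eta>)" using \<xi> nz by (simp add: frac_less2)
    ultimately have A: "\<alpha> - \<tau> \<le> 0" using \<xi>(4) by (auto simp: mult_le_0_iff)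
    then have "0 \<le> (\<beta> - 1 + \<tau>) * \<eta>" unfolding eq using \<xi>(4) by (simp add: mult_nonpos_nonneg)
    then have "\<beta> - 1 + \<tau> \<le> 0" using \<xi>(5) by (auto simp: zero_le_mult_iff)
    with A show ?thesis by simp
  qed
  with pos eX eY that show ?thesis by blast
qed

subsection \<open>The lower Bellman function\<close>

lemma bellman_b_le_cand:
  assumes C: "1 < C" and x: "(x1, x2) \<in> Omega C" and p: "1 < p" "p \<le> 2"
    and lr: "l < r" "{l<..<r} \<subseteq> Q" "Q \<subseteq> {l..r}"
  shows "bellman_b p C Q (x1, x2) \<le> ereal (cand_b p C (x1, x2))"
proof -
  let ?u = "u_plus C (x1, x2)" and ?\<xi> = "xi_plus C"
  define s where "s = (x1 - ?u) / ?\<xi>"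
  let ?J = "LBINT t:{?u..}. \<bar>t\<bar> powr (p - 1) * sgn t * exp (- t / ?\<xi>)"
  note E = u_plus_E_class[OF C x lr, folded s_def]
  have "nn_avg Q (\<lambda>t. \<bar>log_step l ?u ?\<xi> (s * (r - l)) r 0 t\<bar> powr p) =
      ereal (s * (\<bar>?u\<bar> powr p + p * exp (?u / ?\<xi>) * ?J) + (1 - s) * \<bar>?u\<bar> powr p)"
  proof (rule nn_avg_log_step[OF lr E(3,4)])
    assume "0 < s"
    then show "((\<lambda>t. \<bar>?u + ?\<xi> * ln (s * (r - l) / (t - l))\<bar> powr p) has_integral
        s * (r - l) * (\<bar>?u\<bar> powr p + p * exp (?u / ?\<xi>) * ?J)) {l..l + s * (r - l)}"
      using log_powr_has_integral[OF p E(1), of "s * (r - l)"] lr(1) by simp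
  qed simp
  also have "s * (\<bar>?u\<bar> powr p + p * exp (?u / ?\<xi>) * ?J) + (1 - s) * \<bar>?u\<bar> powr p =
      cand_b p C (x1, x2)"
    proof -
    have alg: "s * (a + p * e * J) + (1 - s) * a = p / ?\<xi> * e * J * (s * ?\<xi>) + a" for a e J
      using E(1) by (simp add: algebra_simps)
    have cand: "cand_b p C (x1, x2) = p / ?\<xi> * exp (?u / ?\<xi>) * ?J * (x1 - ?u) + \<bar>?u\<bar> powr p"
      using C p by (simp add: cand_b_def Let_def)
    have "x1 - ?u = s * ?\<xi>" using E(1) by (simp add: s_def)
    then show ?thesis unfolding cand by (simp only: alg)
  qed
  finally show ?thesis
    unfolding bellman_b_def by (intro INF_lower2[OF E(7)]) simp
qed

lemma bellman_b1_le_cand: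
  assumes C: "1 < C" and x: "(x1, x2) \<in> Omega C"
    and lr: "l < r" "{l<..<r} \<subseteq> Q" "Q \<subseteq> {l..r}"
  shows "bellman_b 1 C Q (x1, x2) \<le> ereal (cand_b 1 C (x1, x2))"
proof -
  let ?\<xi> = "xi_plus C" and ?\<eta> = "xi_minus C"
  have C1: "1 \<le> C" using C by simp
  note root = xi_plus_root[OF C1] xi_minus_root[OF C1]
  have Ce: "C * exp ?\<eta> = 1 / (1 - ?\<eta>)" "C * exp ?\<xi> = 1 / (1 - ?\<xi>)"
    using root by (auto intro!: times_exp_root[OF C1])
  have cand: "cand_b 1 C (x1, x2) = cand_b1 C (x1, x2)" using C by (simp add: cand_b_def Let_def)
  have bellman: "bellman_b 1 C Q (x1, x2) \<le> ereal y"
    if "\<phi> \<in> E_class (x1, x2) C Q" "((\<lambda>t. \<bar>\<phi> t\<bar>) has_integral (r - l) * y) {l..r}" for \<phi> y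
    unfolding bellman_b_def
    by (rule INF_lower2[OF that(1)]) (simp add: nn_avg_abs[OF lr that(2), simplified])
  consider "(x1, x2) \<in> Omega_minus C" | "(x1, x2) \<notin> Omega_minus C" "(x1, x2) \<in> Omega_plus C"
    | "(x1, x2) \<notin> Omega_minus C" "(x1, x2) \<notin> Omega_plus C" "(x1, x2) \<in> Omega_zero C"
    using Omega_cover x by blast
  then show ?thesis
  proof cases
    case 1
    let ?u = "u_minus C (x1, x2)"
    define s where "s = (x1 - ?u) / ?\<eta>"
    let ?\<phi> = "log_step l ?u ?\<eta> (s * (r - l)) r 0"
    note E = u_minus_E_class[OF C x lr, folded s_def]
    have "?u \<le> 0"
    proof (cases "x1 \<le> ?\<eta>")
      case True
      then show ?thesis using u_minus_props[OF C1 x] by simp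
    next
      case False
      then have "x2 \<le> exp 0 * ((x1 - 0) / (1 - ?\<eta>) + 1)"
        using 1 Ce by (auto simp: Omega_minus_def)
      then show ?thesis using u_minus_le[OF C1 x, of 0] False by simp
    qed
    then have neg: "?\<phi> t \<le> 0" if "t \<in> {l..r}" for t
      using log_step_bounds(2)[of l t "s * (r - l)" r ?\<eta> ?u 0] that E(1,2) lr(1) by simp
    have "((\<lambda>t. - ?\<phi> t) has_integral - ((r - l) * x1)) {l..r}"
      by (intro has_integral_neg E_class_has_integral[OF lr E(5)])
    then have "((\<lambda>t. \<bar>?\<phi> t\<bar>) has_integral (r - l) * - x1) {l..r}"
      by (subst (asm) has_integral_cong[of _ _ "\<lambda>t. \<bar>?\<phi> t\<bar>"]) (use neg in auto)
    from bellman[OF E(5) this] show ?thesis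
      using 1 by (simp add: cand cand_b1_def Let_def)
  next
    case 2
    let ?u = "u_plus C (x1, x2)"
    define s where "s = (x1 - ?u) / ?\<xi>"
    let ?\<phi> = "log_step l ?u ?\<xi> (s * (r - l)) r 0"
    note E = u_plus_E_class[OF C x lr, folded s_def]
    have "0 \<le> ?u"
    proof (cases "?\<xi> \<le> x1")
      case True
      then show ?thesis using u_plus_props[OF C1 x] by simp
    next
      case False
      then have "x2 \<le> exp 0 * ((x1 - 0) / (1 - ?\<xi>) + 1)"
        using 2 Ce by (auto simp: Omega_plus_def)
      then show ?thesis using u_plus_le_iff(2)[OF C1 x, of 0] False by simp
    qed
    then have pos: "0 \<le> ?\<phi> t" if "t \<in> {l..r}" for t
      using log_step_bounds(1)[of l t "s * (r - l)" r ?\<xi> ?u 0] that E(1,3) lr(1) by simp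
    have "((\<lambda>t. \<bar>?\<phi> t\<bar>) has_integral (r - l) * x1) {l..r}"
      using E_class_has_integral[OF lr E(7)]
      by (subst (asm) has_integral_cong[of _ _ "\<lambda>t. \<bar>?\<phi> t\<bar>"]) (use pos in auto)
    from bellman[OF E(7) this] show ?thesis
      using 2 by (simp add: cand cand_b1_def Let_def)
  next
    case 3
    have \<xi>: "?\<xi> < 1" "0 < ?\<xi>" "?\<eta> < 0"
      using root root_nonzero[OF C] by (auto simp: less_le)
    have le: "x2 \<le> C * exp x1" using x by (simp add: Omega_def)
    have Y: "x1 / (1 - ?\<eta>) \<le> x2 - 1 \<and> x1 / (1 - ?\<xi>) \<le> x2 - 1 \<and> ?\<eta> \<le> x1 \<and> x1 \<le> ?\<xi>"
    proof (cases "x1 \<le> 0")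
      case True
      then have "?\<eta> \<le> x1" "x1 / (1 - ?\<eta>) \<le> x2 - 1"
        using 3 Ce \<xi> by (auto simp: Omega_zero_def Omega_plus_def)
      moreover have "x1 / (1 - ?\<xi>) \<le> x1 / (1 - ?\<eta>)"
        using True \<xi> by (simp add: divide_left_mono_neg)
      ultimately show ?thesis using True \<xi> by auto
    next
      case False
      then have "x1 \<le> ?\<xi>" "x1 / (1 - ?\<xi>) \<le> x2 - 1"
        using 3 Ce \<xi> by (auto simp: Omega_zero_def Omega_plus_def)
      moreover have "x1 / (1 - ?\<eta>) \<le> x1 / (1 - ?\<xi>)"
        using False \<xi> by (simp add: divide_left_mono)
      ultimately show ?thesis using False \<xi> by auto
    qed
    then obtain \<alpha> \<beta> where ab: "0 \<le> \<alpha>" "0 \<le> \<beta>" "\<alpha> + \<beta> \<le> 1" and X: "x1 = \<alpha> * ?\<xi> + \<beta> * ?\<eta>"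
      and Y': "x2 - 1 = \<alpha> * ?\<xi> / (1 - ?\<xi>) + \<beta> * ?\<eta> / (1 - ?\<eta>)"
      using wedge_coordinates[OF C, of x1 "x2 - 1"] le by auto
    let ?A = "\<alpha> * (r - l)" and ?c = "r - \<beta> * (- ?\<eta> / (?\<xi> - ?\<eta>)) * (r - l)" and ?w = "0 + ?\<eta> - ?\<xi>"
    let ?\<phi> = "log_step l 0 ?\<xi> ?A ?c ?w"
    have x1: "x1 = 0 + \<alpha> * ?\<xi> + \<beta> * ?\<eta>" using X by simp
    have x2: "x2 = exp 0 * (1 + \<alpha> * ?\<xi> / (1 - ?\<xi>) + \<beta> * ?\<eta> / (1 - ?\<eta>))" using Y' by simp
    note E = log_step_E_class[OF C lr ab x1 x2 le]
    have A: "0 \<le> ?A" using ab lr by simp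
    have "(?\<phi> has_integral ?A * ?\<xi>) {l..?c}"
      using moments_has_integral[OF E(4)] by simp
    then have 1: "((\<lambda>t. \<bar>?\<phi> t\<bar>) has_integral ?A * ?\<xi>) {l..?c}"
      using log_step_bounds(1)[of l _ ?A ?c ?\<xi> 0 ?w] A \<xi>
      by (subst (asm) has_integral_cong[of _ _ "\<lambda>t. \<bar>?\<phi> t\<bar>"]) auto
    have 2: "((\<lambda>t. \<bar>?\<phi> t\<bar>) has_integral (r - ?c) * (?\<xi> - ?\<eta>)) {?c..r}"
    proof (rule has_integral_spike_finite[of "{?c}"])
      show "((\<lambda>_. ?\<xi> - ?\<eta>) has_integral (r - ?c) * (?\<xi> - ?\<eta>)) {?c..r}"
        using has_integral_const_real[of "?\<xi> - ?\<eta>" ?c r] E(3) by simp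
      show "\<bar>?\<phi> t\<bar> = ?\<xi> - ?\<eta>" if "t \<in> {?c..r} - {?c}" for t
        using that E(2) \<xi> by (auto simp: log_step_def)
    qed simp
    have "((\<lambda>t. \<bar>?\<phi> t\<bar>) has_integral ?A * ?\<xi> + (r - ?c) * (?\<xi> - ?\<eta>)) {l..r}"
      using A E(2,3) by (intro has_integral_combine[OF _ _ 1 2]) auto
    moreover have "(r - ?c) * (?\<xi> - ?\<eta>) = (r - l) * - (\<beta> * ?\<eta>)"
      using \<xi> by simp
    ultimately have "((\<lambda>t. \<bar>?\<phi> t\<bar>) has_integral (r - l) * (\<alpha> * ?\<xi> - \<beta> * ?\<eta>)) {l..r}"
      by (simp add: algebra_simps)
    from bellman[OF E(1) this]
    have "bellman_b 1 C Q (x1, x2) \<le> ereal (\<alpha> * ?\<xi> - \<beta> * ?\<eta>)" .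
    also have "\<alpha> * ?\<xi> - \<beta> * ?\<eta> = cand_b1 C (x1, x2)"
    proof -
      define a where "a = \<alpha> * ?\<xi>"
      define b where "b = \<beta> * ?\<eta>"
      have nz: "1 - ?\<xi> \<noteq> 0" "1 - ?\<eta> \<noteq> 0" "?\<xi> - ?\<eta> \<noteq> 0" using \<xi> by auto
      have "(1 - ?\<eta>) * (1 - ?\<xi>) * (x2 - 1) = a * (1 - ?\<eta>) + b * (1 - ?\<xi>)"
      proof -
        have "(1 - ?\<eta>) * (1 - ?\<xi>) * (a / (1 - ?\<xi>)) = a * (1 - ?\<eta>)"
          "(1 - ?\<eta>) * (1 - ?\<xi>) * (b / (1 - ?\<eta>)) = b * (1 - ?\<xi>)"
          using nz by simp_all
        then show ?thesis
          unfolding Y' a_def[symmetric] b_def[symmetric] by (simp only: distrib_left)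
      qed
      then have "2 * ((1 - ?\<eta>) * (1 - ?\<xi>) * (x2 - 1)) + (?\<xi> + ?\<eta> - 2) * x1 = (a - b) * (?\<xi> - ?\<eta>)"
        unfolding X a_def[symmetric] b_def[symmetric] by (simp add: algebra_simps)
      then have "a - b = (2 * ((1 - ?\<eta>) * (1 - ?\<xi>) * (x2 - 1)) + (?\<xi> + ?\<eta> - 2) * x1) / (?\<xi> - ?\<eta>)"
        using nz by simp
      then show ?thesis
        using 3 by (simp add: cand_b1_def Let_def a_def b_def add_divide_distrib)
    qed
    finally show ?thesis by (simp add: cand)
  qed
qed

subsection \<open>The quadratic and exponential Bellman functions\<close>

lemma cand_B2_le_bellman:
  assumes C: "1 < C" and x: "(x1, x2) \<in> Omega C"
    and lr: "l < r" "{l<..<r} \<subseteq> Q" "Q \<subseteq> {l..r}"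
  shows "ereal (cand_B2 C (x1, x2)) \<le> bellman_B2 C Q (x1, x2)"
proof -
  let ?u = "u_minus C (x1, x2)" and ?\<xi> = "xi_minus C"
  define s where "s = (x1 - ?u) / ?\<xi>"
  note E = u_minus_E_class[OF C x lr, folded s_def]
  have "nn_avg Q (\<lambda>t. (log_step l ?u ?\<xi> (s * (r - l)) r 0 t)\<^sup>2) =
      ereal (s * ((?u + ?\<xi>)\<^sup>2 + ?\<xi>\<^sup>2) + (1 - s) * ?u\<^sup>2)"
  proof (rule nn_avg_log_step[OF lr E(2,3), where f = "\<lambda>y. y\<^sup>2"])
    assume s: "0 < s"
    then have "0 < s * (r - l)" using lr(1) by simp
    then show "((\<lambda>t. (?u + ?\<xi> * ln (s * (r - l) / (t - l)))\<^sup>2) has_integral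
        s * (r - l) * ((?u + ?\<xi>)\<^sup>2 + ?\<xi>\<^sup>2)) {l..l + s * (r - l)}"
      using log_square_has_integral[of l "l + s * (r - l)" "s * (r - l)" ?u ?\<xi>] s lr(1) by simp
  qed simp
  also have "s * ((?u + ?\<xi>)\<^sup>2 + ?\<xi>\<^sup>2) + (1 - s) * ?u\<^sup>2 = cand_B2 C (x1, x2)"
  proof -
    have "s * ((y + ?\<xi>)\<^sup>2 + ?\<xi>\<^sup>2) + (1 - s) * y\<^sup>2 = 2 * y * X - y\<^sup>2 + 2 * ?\<xi> * (X - y)"
      if "X = y + s * ?\<xi>" for X y
      unfolding that by (simp add: power2_eq_square algebra_simps)
    from this[OF E(4)] show ?thesis
      using C by (simp add: cand_B2_def Let_def)
  qed
  finally show ?thesis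
    unfolding bellman_B2_def by (intro SUP_upper2[OF E(5)]) simp
qed

lemma cand_A_le_bellman:
  assumes C: "1 < C" and x: "(x1, x2) \<in> Omega C" and \<delta>: "1 \<le> \<delta>" "\<delta> * xi_plus C < 1"
    and lr: "l < r" "{l<..<r} \<subseteq> Q" "Q \<subseteq> {l..r}"
  shows "ereal (cand_A \<delta> C (x1, x2)) \<le> bellman_A \<delta> C Q (x1, x2)"
proof -
  let ?u = "u_plus C (x1, x2)" and ?\<xi> = "xi_plus C"
  define s where "s = (x1 - ?u) / ?\<xi>"
  note E = u_plus_E_class[OF C x lr, folded s_def]
  have "nn_avg Q (\<lambda>t. exp (\<delta> * log_step l ?u ?\<xi> (s * (r - l)) r 0 t)) =
      ereal (s * (exp (\<delta> * ?u) / (1 - \<delta> * ?\<xi>)) + (1 - s) * exp (\<delta> * ?u))"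
  proof (rule nn_avg_log_step[OF lr E(3,4), where f = "\<lambda>y. exp (\<delta> * y)"])
    assume s: "0 < s"
    let ?\<alpha> = "s * (r - l)"
    have \<alpha>: "0 < ?\<alpha>" using s lr(1) by simp
    have "moments (\<lambda>t. \<delta> * ?u + \<delta> * ?\<xi> * ln (?\<alpha> / (t - l))) l (l + ?\<alpha>)
        (((l + ?\<alpha>) - l) * (\<delta> * ?u + \<delta> * ?\<xi> * ln (?\<alpha> / ((l + ?\<alpha>) - l)) + \<delta> * ?\<xi>))
        (((l + ?\<alpha>) - l) * (exp (\<delta> * ?u + \<delta> * ?\<xi> * ln (?\<alpha> / ((l + ?\<alpha>) - l))) / (1 - \<delta> * ?\<xi>)))"
      by (rule moments_log) (use \<alpha> \<delta> in auto)
    from moments_exp_has_integral[OF this]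
    show "((\<lambda>t. exp (\<delta> * (?u + ?\<xi> * ln (?\<alpha> / (t - l))))) has_integral
        ?\<alpha> * (exp (\<delta> * ?u) / (1 - \<delta> * ?\<xi>))) {l..l + ?\<alpha>}"
      using \<alpha> s lr(1) by (simp add: distrib_left mult.assoc[symmetric])
  qed simp
  also have "s * (exp (\<delta> * ?u) / (1 - \<delta> * ?\<xi>)) + (1 - s) * exp (\<delta> * ?u) = cand_A \<delta> C (x1, x2)"
  proof -
    have "s * (E / (1 - \<delta> * ?\<xi>)) + (1 - s) * E = E * (\<delta> / (1 - \<delta> * ?\<xi>) * (s * ?\<xi>) + 1)" for E
    proof -
      have "1 / (1 - \<delta> * ?\<xi>) = 1 + \<delta> * ?\<xi> / (1 - \<delta> * ?\<xi>)" using \<delta>(2) by (simp add: field_simps)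
      then have "s * (E * (1 / (1 - \<delta> * ?\<xi>))) + (1 - s) * E =
          E * (s * (1 + \<delta> * ?\<xi> / (1 - \<delta> * ?\<xi>)) + (1 - s))"
        by (simp only:) (simp add: algebra_simps)
      then show ?thesis by (simp add: algebra_simps)
    qed
    moreover have "s * ?\<xi> = x1 - ?u" using E(1) by (simp add: s_def)
    ultimately show ?thesis
      using C by (simp add: cand_A_def Let_def)
  qed
  finally show ?thesis
    unfolding bellman_A_def by (intro SUP_upper2[OF E(7)]) simp
qed

subsection \<open>The distribution Bellman function\<close>

lemma bellman_D_ge:
  assumes lr: "l < r" "{l<..<r} \<subseteq> Q" "Q \<subseteq> {l..r}" and \<phi>: "\<phi> \<in> E_class x C Q"
    and c: "l \<le> c" "c \<le> r" "\<And>t. l < t \<Longrightarrow> t < c \<Longrightarrow> lam \<le> \<phi> t" "\<And>t. c < t \<Longrightarrow> t \<le> r \<Longrightarrow> \<phi> t < lam"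
  shows "ereal ((c - l) / (r - l)) \<le> bellman_D lam C Q x"
proof -
  have "{l<..<c} \<subseteq> {t \<in> Q. lam \<le> \<phi> t}"
  proof
    fix t assume "t \<in> {l<..<c}"
    then show "t \<in> {t \<in> Q. lam \<le> \<phi> t}" using lr(2) c by auto
  qed
  moreover have "{t \<in> Q. lam \<le> \<phi> t} \<subseteq> {l..c}"
    using lr(3) c(4) by (force simp: not_less[symmetric])
  ultimately have "measure lebesgue {t \<in> Q. lam \<le> \<phi> t} = c - l"
    by (rule measure_between(2)[OF c(1)])
  moreover have "measure lebesgue Q = r - l" using measure_between(2)[of l r Q] lr by simp
  ultimately show ?thesis
    unfolding bellman_D_def by (intro SUP_upper2[OF \<phi>]) simp
qed

lemma v_chord_props:
  assumes x: "x1 < lam" "exp x1 \<le> x2" "w \<le> x1"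
  defines "q \<equiv> (x2 - exp lam) / (x1 - lam)"
  assumes w: "q * (w - lam) \<le> exp w - exp lam"
  defines "v \<equiv> v_chord lam (x1, x2)"
  shows "w \<le> v" "v \<le> x1" "exp v - exp lam = q * (v - lam)"
proof -
  have slope: "v < lam \<and> (exp v - exp lam) / (v - lam) = (x2 - exp lam) / (x1 - lam) \<longleftrightarrow>
      v < lam \<and> exp v - exp lam = q * (v - lam)" for v
    by (auto simp: q_def divide_eq_eq)
  let ?h = "\<lambda>v. exp v - exp lam - q * (v - lam)"
  have "q * (x1 - lam) = x2 - exp lam" using x(1) by (simp add: q_def)
  then have "\<exists>v. w \<le> v \<and> v \<le> x1 \<and> ?h v = 0"
    using x w by (intro IVT2') (auto intro!: continuous_intros)
  then obtain v0 where v0: "w \<le> v0" "v0 \<le> x1" "exp v0 - exp lam = q * (v0 - lam)" by auto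
  have lt: False if "a < b" "b < lam" "exp a - exp lam = q * (a - lam)" "exp b - exp lam = q * (b - lam)" for a b
  proof -
    have "q * (b - a) = exp b - exp a" using that(3,4) by (simp add: algebra_simps)
    also have "exp b * (1 + (a - b)) < exp b * exp (a - b)"
      using one_plus_less_exp[of "a - b"] that(1) by (intro mult_strict_left_mono) auto
    then have "exp b - exp a < exp b * (b - a)" by (simp add: mult_exp_exp algebra_simps)
    finally have "q < exp b" using that(1) by simp
    have "exp b * (1 + (lam - b)) < exp b * exp (lam - b)"
      using one_plus_less_exp[of "lam - b"] that(2) by (intro mult_strict_left_mono) auto
    then have "exp b * (lam - b) < exp lam - exp b" by (simp add: mult_exp_exp algebra_simps)
    also have "\<dots> = q * (lam - b)" using that(4) by (simp add: algebra_simps)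
    finally have "exp b < q" using that(2) by simp
    with \<open>q < exp b\<close> show False by simp
  qed
  have "\<exists>!v. v < lam \<and> (exp v - exp lam) / (v - lam) = (x2 - exp lam) / (x1 - lam)"
    unfolding slope
  proof (rule ex1I[of _ v0])
    show "v0 < lam \<and> exp v0 - exp lam = q * (v0 - lam)" using v0 x(1) by simp
    show "v = v0" if "v < lam \<and> exp v - exp lam = q * (v - lam)" for v
      using lt[of v v0] lt[of v0 v] that v0 x(1) by fastforce
  qed
  from the1_equality[OF this, of v0] have "v = v0"
    using slope[of v0] v0 x(1) by (simp add: v_def v_chord_def)
  with v0 show "w \<le> v" "v \<le> x1" "exp v - exp lam = q * (v - lam)" by simp_all
qed

lemma cand_D_le_bellman:
  assumes C: "1 < C" and x: "(x1, x2) \<in> Omega C"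
    and lr: "l < r" "{l<..<r} \<subseteq> Q" "Q \<subseteq> {l..r}"
  shows "ereal (cand_D lam C (x1, x2)) \<le> bellman_D lam C Q (x1, x2)"
proof -
  define \<xi> where "\<xi> = xi_plus C"
  define \<eta> where "\<eta> = xi_minus C"
  define u where "u = u_plus C (x1, x2)"
  define s where "s = (x1 - u) / \<xi>"
  define w where "w = lam + \<eta> - \<xi>"
  have C1: "1 \<le> C" using C by simp
  have \<xi>: "\<xi> < 1" "0 < \<xi>" "\<eta> < 0"
    using xi_plus_root[OF C1] xi_minus_root[OF C1] root_nonzero[OF C] by (auto simp: \<xi>_def \<eta>_def less_le)
  have Ce: "C * exp \<eta> = 1 / (1 - \<eta>)" "C * exp \<xi> = 1 / (1 - \<xi>)"
    unfolding \<xi>_def \<eta>_def using xi_plus_root[OF C1] xi_minus_root[OF C1]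
    by (auto intro!: times_exp_root[OF C1])
  have ew: "exp w = exp lam * (1 - \<xi>) / (1 - \<eta>)"
    using exp_tangent_chord[OF C1, of lam] by (simp add: w_def \<xi>_def \<eta>_def)
  have wl: "w < lam" using \<xi> by (simp add: w_def)
  note E = u_plus_E_class[OF C x lr, folded \<xi>_def u_def, folded s_def]
  note u = u_plus_props[OF C1 x, folded \<xi>_def u_def]
  note regions = D_region1_def D_region2_def D_region3_def D_region4_def
  have om: "exp x1 \<le> x2" "x2 \<le> C * exp x1" using x by (auto simp: Omega_def)
  let ?x = "(x1, x2)"
  consider "?x \<in> D_region4 lam C"
    | "?x \<notin> D_region4 lam C" "?x \<in> D_region3 lam C"
    | "?x \<notin> D_region4 lam C" "?x \<notin> D_region3 lam C" "?x \<in> D_region2 lam C"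
    | "?x \<notin> D_region4 lam C" "?x \<notin> D_region3 lam C" "?x \<notin> D_region2 lam C" "?x \<in> D_region1 lam C"
    using D_region_cover x by blast
  then show ?thesis
  proof cases
    case 1
    let ?\<phi> = "log_step l u \<xi> (s * (r - l)) r 0"
    have "lam \<le> u"
    proof (cases "lam + \<xi> \<le> x1")
      case True
      then show ?thesis using u by simp
    next
      case False
      then have "x2 \<le> exp lam * ((x1 - lam) / (1 - \<xi>) + 1)"
        using 1 Ce by (auto simp: regions \<xi>_def)
      then show ?thesis
        using u_plus_le_iff(2)[OF C1 x, of lam] False by (simp add: u_def \<xi>_def)
    qed
    then have "lam \<le> ?\<phi> t" if "l < t" "t < r" for t
      using log_step_bounds(1)[of l t "s * (r - l)" r \<xi> u 0] that E(1,3) lr(1) by simp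
    then have "ereal ((r - l) / (r - l)) \<le> bellman_D lam C Q ?x"
      using lr(1) by (intro bellman_D_ge[OF lr E(7)]) auto
    then show ?thesis using 1 C lr(1) by (simp add: cand_D_def Let_def one_ereal_def)
  next
    case 2
    define X where "X = x1 - lam"
    define Y where "Y = x2 * exp (- lam) - 1"
    have x2Y: "x2 = exp lam * (1 + Y)" by (simp add: Y_def exp_minus)
    have Yiff: "exp lam * (a + 1) \<le> x2 \<longleftrightarrow> a \<le> Y" for a
      unfolding x2Y by (simp add: add.commute)
    have XY: "1 + Y \<le> C * exp X"
      using om(2) by (simp add: X_def Y_def exp_diff exp_minus field_simps)
    have Y: "X / (1 - \<eta>) \<le> Y \<and> X / (1 - \<xi>) \<le> Y \<and> \<eta> \<le> X \<and> X \<le> \<xi>"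
    proof (cases "X \<le> 0")
      case True
      then have "\<eta> \<le> X" "X / (1 - \<eta>) \<le> Y"
        using 2 Ce \<xi> unfolding Yiff[symmetric] by (auto simp: regions X_def \<xi>_def \<eta>_def)
      moreover have "X / (1 - \<xi>) \<le> X / (1 - \<eta>)"
        using True \<xi> by (simp add: divide_left_mono_neg)
      ultimately show ?thesis using True \<xi> by auto
    next
      case False
      then have "X \<le> \<xi>" "X / (1 - \<xi>) \<le> Y"
        using 2 Ce \<xi> unfolding Yiff[symmetric] by (auto simp: regions X_def \<xi>_def \<eta>_def)
      moreover have "X / (1 - \<eta>) \<le> X / (1 - \<xi>)"
        using False \<xi> by (simp add: divide_left_mono)
      ultimately show ?thesis using False \<xi> by auto
    qed
    then obtain \<alpha> \<beta> where ab: "0 \<le> \<alpha>" "0 \<le> \<beta>" "\<alpha> + \<beta> \<le> 1" and eX: "X = \<alpha> * \<xi> + \<beta> * \<eta>"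
      and eY: "Y = \<alpha> * \<xi> / (1 - \<xi>) + \<beta> * \<eta> / (1 - \<eta>)"
      using wedge_coordinates[OF C, of X Y] XY by (auto simp: \<xi>_def \<eta>_def)
    have x1: "x1 = lam + \<alpha> * \<xi> + \<beta> * \<eta>" using eX by (simp add: X_def)
    have x2: "x2 = exp lam * (1 + \<alpha> * \<xi> / (1 - \<xi>) + \<beta> * \<eta> / (1 - \<eta>))"
      unfolding x2Y eY by (simp add: add.assoc)
    let ?A = "\<alpha> * (r - l)" and ?c = "r - \<beta> * (- \<eta> / (\<xi> - \<eta>)) * (r - l)"
    let ?\<phi> = "log_step l lam \<xi> ?A ?c (lam + \<eta> - \<xi>)"
    note F = log_step_E_class[OF C lr ab, folded \<xi>_def \<eta>_def, OF x1 x2 om(2)]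
    have A: "0 \<le> ?A" using ab lr by simp
    have "ereal ((?c - l) / (r - l)) \<le> bellman_D lam C Q ?x"
    proof (rule bellman_D_ge[OF lr F(1) _ F(3)])
      show "l \<le> ?c" using A F(2) by linarith
      show "lam \<le> ?\<phi> t" if "l < t" "t < ?c" for t
        using log_step_bounds(1)[of l t ?A ?c \<xi> lam] that A \<xi> by simp
      show "?\<phi> t < lam" if "?c < t" "t \<le> r" for t
        using that F(2) \<xi> by (simp add: log_step_def)
    qed
    moreover have "(?c - l) / (r - l) = cand_D lam C ?x"
    proof -
      define b where "b = \<beta> * \<eta>"
      have nz: "1 - \<xi> \<noteq> 0" "1 - \<eta> \<noteq> 0" "\<xi> - \<eta> \<noteq> 0" using \<xi> by auto
      have c: "?c - l = (1 + b / (\<xi> - \<eta>)) * (r - l)"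
        by (simp add: b_def algebra_simps)
      have "(1 - \<eta>) * (X - Y * (1 - \<xi>)) = b * (\<xi> - \<eta>)"
      proof -
        have "Y * (1 - \<xi>) = \<alpha> * \<xi> + b * (1 - \<xi>) / (1 - \<eta>)"
          unfolding eY b_def using nz by (simp add: distrib_right)
        then have "X - Y * (1 - \<xi>) = b - b * (1 - \<xi>) / (1 - \<eta>)"
          unfolding eX b_def by linarith
        then have "(1 - \<eta>) * (X - Y * (1 - \<xi>)) = (1 - \<eta>) * b - (1 - \<eta>) * (b * (1 - \<xi>) / (1 - \<eta>))"
          by (simp only: right_diff_distrib)
        also have "(1 - \<eta>) * (b * (1 - \<xi>) / (1 - \<eta>)) = b * (1 - \<xi>)" using nz by simp
        finally show ?thesis by (simp add: algebra_simps)
      qed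
      then have "(1 - \<eta>) / (\<xi> - \<eta>)\<^sup>2 * (X + - Y * (1 - \<xi>)) + 1 = b / (\<xi> - \<eta>) + 1"
        using nz by (simp add: power2_eq_square)
      moreover have "cand_D lam C ?x = (1 - \<eta>) / (\<xi> - \<eta>)\<^sup>2 * (X + - Y * (1 - \<xi>)) + 1"
        using 2 C by (simp add: cand_D_def Let_def X_def Y_def \<xi>_def \<eta>_def)
      ultimately show ?thesis unfolding c using lr(1) by simp
    qed
    ultimately show ?thesis by simp
  next
    case 3
    let ?q = "(x2 - exp lam) / (x1 - lam)"
    have r2: "w \<le> x1" "x1 < lam" "x2 \<le> exp lam * ((x1 - lam) / (1 - \<eta>) + 1)"
      using 3 Ce by (auto simp: regions w_def \<xi>_def \<eta>_def)
    have q: "exp lam / (1 - \<eta>) \<le> ?q"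
      using r2 by (simp add: neg_le_divide_eq algebra_simps)
    have "exp w - exp lam = exp lam / (1 - \<eta>) * (w - lam)"
      unfolding ew using \<xi> by (simp add: w_def field_simps)
    moreover have "?q * (w - lam) \<le> exp lam / (1 - \<eta>) * (w - lam)"
      using q wl by (intro mult_right_mono_neg) auto
    ultimately have "?q * (w - lam) \<le> exp w - exp lam" by simp
    note V = v_chord_props[OF r2(2) om(1) r2(1) this]
    define v where "v = v_chord lam ?x"
    note V = V[folded v_def]
    define \<theta> where "\<theta> = (x1 - v) / (lam - v)"
    have vl: "v < lam" using V r2 by simp
    have \<theta>: "0 \<le> \<theta>" "\<theta> \<le> 1" using V vl r2 by (auto simp: \<theta>_def)
    have \<theta>v: "\<theta> * (lam - v) = x1 - v" using vl by (simp add: \<theta>_def)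
    have x1: "x1 = \<theta> * lam + (1 - \<theta>) * v" using \<theta>v by (simp add: algebra_simps)
    have x2: "x2 = \<theta> * exp lam + (1 - \<theta>) * exp v"
    proof -
      have "\<theta> * exp lam + (1 - \<theta>) * exp v = exp lam + (1 - \<theta>) * (exp v - exp lam)"
        by (simp add: algebra_simps)
      also have "\<dots> = exp lam + ?q * ((v - lam) + \<theta> * (lam - v))"
      proof -
        have "(1 - \<theta>) * (q * (v - lam)) = q * ((v - lam) + \<theta> * (lam - v))" for q
          by (simp add: algebra_simps)
        then show ?thesis unfolding V(3) by (simp only:)
      qed
      also have "\<dots> = exp lam + ?q * (x1 - lam)" unfolding \<theta>v by simp
      also have "\<dots> = x2" using r2(2) by simp
      finally show ?thesis by simp
    qed
    have v: "lam + xi_minus C - xi_plus C \<le> v" "v \<le> lam"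
      using V(1) vl by (simp_all add: w_def \<xi>_def \<eta>_def)
    have "\<theta> * (r - l) \<le> r - l" using \<theta> lr(1) by (intro mult_left_le_one_le) auto
    then have "l + \<theta> * (r - l) \<le> r" by (simp only: le_diff_eq add.commute)
    moreover have "0 \<le> \<theta> * (r - l)" using \<theta> lr(1) by simp
    ultimately have "ereal ((l + \<theta> * (r - l) - l) / (r - l)) \<le> bellman_D lam C Q ?x"
      using vl by (intro bellman_D_ge[OF lr two_values_E_class[OF C1 lr v \<theta> x1 x2]]) auto
    moreover have "cand_D lam C ?x = \<theta>"
      using 3 C by (simp add: cand_D_def Let_def \<theta>_def v_def)
    ultimately show ?thesis using lr(1) by simp
  next
    case 4
    have uw: "u \<le> w"
    proof (cases "x1 \<le> w")
      case True
      then show ?thesis using u by simp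
    next
      case False
      then have r1: "x1 \<le> lam + \<eta>" "exp lam * ((x1 - lam) / (1 - \<eta>) + 1) \<le> x2"
        using 4 Ce by (auto simp: regions w_def \<xi>_def \<eta>_def)
      have "exp w * ((x1 - w) / (1 - \<xi>) + 1) = exp lam * ((x1 - lam) / (1 - \<eta>) + 1)"
      proof -
        have "(x1 - w) / (1 - \<xi>) + 1 = (x1 - w + (1 - \<xi>)) / (1 - \<xi>)"
          "(x1 - lam) / (1 - \<eta>) + 1 = (x1 - lam + (1 - \<eta>)) / (1 - \<eta>)"
          using \<xi> by (simp_all add: add_divide_distrib)
        moreover have "x1 - w + (1 - \<xi>) = x1 - lam + (1 - \<eta>)" by (simp add: w_def)
        ultimately show ?thesis unfolding ew using \<xi> by simp
      qed
      then show ?thesis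
        using r1 u_plus_le_iff(1)[OF C1 x, of w] by (simp add: u_def \<xi>_def w_def)
    qed
    have cand: "cand_D lam C ?x = s * (\<xi> / (\<xi> - \<eta>)) * exp ((u - w) / \<xi>)"
    proof -
      have "\<xi> - \<eta> + u - lam = u - w" by (simp add: w_def)
      then have "cand_D lam C ?x = 1 / (\<xi> - \<eta>) * exp ((u - w) / \<xi>) * (x1 - u)"
        using 4 C by (simp add: cand_D_def Let_def \<xi>_def \<eta>_def u_def)
      moreover have "x1 - u = s * \<xi>" using \<xi> by (simp add: s_def)
      ultimately show ?thesis by simp
    qed
    show ?thesis
    proof (cases "s = 0")
      case True
      have "0 \<le> bellman_D lam C Q ?x"
        unfolding bellman_D_def by (rule SUP_upper2[OF E(7)]) simp
      then show ?thesis using True by (simp add: cand zero_ereal_def)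
    next
      case False
      define \<alpha> where "\<alpha> = s * (r - l)"
      define \<rho> where "\<rho> = \<alpha> * exp ((u - w) / \<xi>)"
      have \<alpha>: "0 < \<alpha>" using False E(3) lr(1) by (simp add: \<alpha>_def)
      have "\<alpha> \<le> r - l"
        unfolding \<alpha>_def using E(3,4) lr(1) by (intro mult_left_le_one_le) auto
      then have \<alpha>r: "l + \<alpha> \<le> r" by simp
      have \<rho>: "0 < \<rho>" using \<alpha> by (simp add: \<rho>_def)
      have "(u - w) / \<xi> \<le> 0" using uw \<xi> by (simp add: divide_le_0_iff)
      then have \<rho>\<alpha>: "\<rho> \<le> \<alpha>" using \<alpha> by (simp add: \<rho>_def)
      have "\<alpha> / \<rho> = exp (- ((u - w) / \<xi>))" using \<alpha> by (simp add: \<rho>_def exp_minus divide_inverse)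
      then have ln\<rho>: "u + \<xi> * ln (\<alpha> / \<rho>) = w" using \<xi> by simp
      have x1: "(r - l) * x1 = \<alpha> * (u + \<xi>) + (r - l - \<alpha>) * u"
        unfolding E(5) \<alpha>_def by (simp add: algebra_simps)
      have x2: "(r - l) * x2 = \<alpha> * (exp u / (1 - \<xi>)) + (r - l - \<alpha>) * exp u"
        unfolding E(6) \<alpha>_def using \<xi>(1) by (simp add: field_simps)
      let ?c = "l + \<rho> * (\<xi> / (\<xi> - \<eta>))"
      note F = step_log_E_class[OF C lr \<rho> \<rho>\<alpha> \<alpha>r ln\<rho>[unfolded w_def \<xi>_def \<eta>_def]
          x1[unfolded \<xi>_def] x2[unfolded \<xi>_def], folded \<xi>_def \<eta>_def, folded w_def]
      have "ereal ((?c - l) / (r - l)) \<le> bellman_D lam C Q ?x"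
      proof (rule bellman_D_ge[OF lr F])
        fix t assume t: "?c < t" "t \<le> r"
        have "log_step l u \<xi> \<alpha> r 0 t \<le> w" if "\<not> t \<le> l + \<rho>"
          unfolding ln\<rho>[symmetric] using that t \<rho> \<rho>\<alpha> \<xi> by (intro log_step_le) auto
        then show "(if t \<le> ?c then lam else if t \<le> l + \<rho> then w else log_step l u \<xi> \<alpha> r 0 t) < lam"
          using t wl by auto
      qed simp
      moreover have "(?c - l) / (r - l) = cand_D lam C ?x"
        using lr(1) by (simp add: cand \<rho>_def \<alpha>_def)
      ultimately show ?thesis by simp
    qed
  qed
qed

lemma Omega_one: "(x1, x2) \<in> Omega 1 \<longleftrightarrow> x2 = exp x1"
  by (auto simp: Omega_def)

theorem lemma5p1:
  fixes C :: real and Q :: "real set"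
  assumes "C \<ge> 1" and "bdd_interval Q"
  shows "(\<forall>p\<in>{1..2}. \<forall>x\<in>Omega C. ereal (cand_b p C x) \<ge> bellman_b p C Q x)
    \<and> (\<forall>x\<in>Omega C. ereal (cand_B2 C x) \<le> bellman_B2 C Q x)
    \<and> (\<forall>\<delta>::real. 1 \<le> \<delta> \<and> ereal \<delta> < 1 / ereal (xi_plus C) \<longrightarrow>
          (\<forall>x\<in>Omega C. ereal (cand_A \<delta> C x) \<le> bellman_A \<delta> C Q x))
    \<and> (\<forall>lam::real. \<forall>x\<in>Omega C. ereal (cand_D lam C x) \<le> bellman_D lam C Q x)"
proof -
  obtain l r where lr: "l < r" "{l<..<r} \<subseteq> Q" "Q \<subseteq> {l..r}"
    using bdd_interval_between[OF assms(2)] .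
  show ?thesis
  proof (cases "C = 1")
    case True
    have E: "(\<lambda>_. x1) \<in> E_class (x1, exp x1) 1 Q" for x1
      using const_E_class[OF _ lr] by simp
    have b: "bellman_b p 1 Q (x1, exp x1) \<le> ereal (cand_b p 1 (x1, exp x1))" for p x1
      unfolding bellman_b_def by (rule INF_lower2[OF E]) (simp add: nn_avg_const[OF lr] cand_b_def)
    have B2: "ereal (cand_B2 1 (x1, exp x1)) \<le> bellman_B2 1 Q (x1, exp x1)" for x1
      unfolding bellman_B2_def by (rule SUP_upper2[OF E]) (simp add: nn_avg_const[OF lr] cand_B2_def)
    have A: "ereal (cand_A \<delta> 1 (x1, exp x1)) \<le> bellman_A \<delta> 1 Q (x1, exp x1)" for \<delta> x1
      unfolding bellman_A_def by (rule SUP_upper2[OF E]) (simp add: nn_avg_const[OF lr] cand_A_def)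
    have D: "ereal (cand_D lam 1 (x1, exp x1)) \<le> bellman_D lam 1 Q (x1, exp x1)" for lam x1
      using bellman_D_ge[OF lr E[of x1], of "if lam \<le> x1 then r else l" lam] lr(1)
      by (cases "lam \<le> x1") (simp_all add: cand_D_def Let_def)
    show ?thesis
      using b B2 A D unfolding True by (auto simp: Omega_one)
  next
    case False
    then have C: "1 < C" using assms(1) by simp
    have \<xi>: "0 < xi_plus C"
      using xi_plus_root[OF assms(1)] root_nonzero[OF C] by (auto simp: less_le)
    have b: "bellman_b p C Q (x1, x2) \<le> ereal (cand_b p C (x1, x2))"
      if "p \<in> {1..2}" "(x1, x2) \<in> Omega C" for p x1 x2
      using bellman_b1_le_cand[OF C that(2) lr] bellman_b_le_cand[OF C that(2) _ _ lr, of p] that(1)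
      by (cases "p = 1") auto
    have A: "ereal (cand_A \<delta> C (x1, x2)) \<le> bellman_A \<delta> C Q (x1, x2)"
      if "1 \<le> \<delta>" "ereal \<delta> < 1 / ereal (xi_plus C)" "(x1, x2) \<in> Omega C" for \<delta> x1 x2
    proof -
      have "ereal \<delta> < ereal (1 / xi_plus C)"
        using that(2) \<xi> by (simp add: one_ereal_def)
      then have "\<delta> * xi_plus C < 1" using \<xi> by (simp add: pos_less_divide_eq)
      then show ?thesis using cand_A_le_bellman[OF C that(3,1) _ lr] by blast
    qed
    show ?thesis
      using b A cand_B2_le_bellman[OF C _ lr] cand_D_le_bellman[OF C _ lr] by auto
  qed
qed

end
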